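(* Let $p$ be a prime, $q\in\mathbb{C}_p$ with $|q-1|_p<p^{-\frac{1}{p-1}}$, $\lambda\in\mathbb{C}_p\setminus\{0\}$, $r\in\mathbb{N}$, and $x\in\mathbb{Z}_p$. For every integer $n\ge0$, \[ \beta_{n,q}^{(r)}(x|\lambda)=\sum_{m=0}^n\lambda^{n-m}\beta_{m,q}^{(r)}(x)S_1(n,m). \]
   Context: $q^x=\exp(x\log q)$, $[x]_q=\frac{1-q^x}{1-q}$. The $p$-adic $q$-integral of a uniformly differentiable $f$ on $\mathbb{Z}_p$ is $\int_{\mathbb{Z}_p}f(y)\,d\mu_q(y)=\lim_{N\to\infty}\frac{1}{[p^N]_q}\sum_{y=0}^{p^N-1}f(y)q^y$. The Carlitz $q$-Bernoulli polynomials of order $r$ are $\beta_{m,q}^{(r)}(x)=\int_{\mathbb{Z}_p}\cdots\int_{\mathbb{Z}_p}[x_1+\cdots+x_r+x]_q^m\,d\mu_q(x_1)\cdots d\mu_q(x_r)$. For $t\in\mathbb{C}_p$ with $|\lambda t|_p<p^{-1/(p-1)}$, $(1+\lambda t)^{a/\lambda}=\exp(\frac{a}{\lambda}\log(1+\lambda t))$, and the degenerate Carlitz $q$-Bernoulli polynomials of order $r$ are defined by $\int_{\mathbb{Z}_p}\cdots\int_{\mathbb{Z}_p}(1+\lambda t)^{\frac{1}{\lambda}[x_1+\cdots+x_r+x]_q}\,d\mu_q(x_1)\cdots d\mu_q(x_r)=\sum_{n\ge0}\beta_{n,q}^{(r)}(x|\lambda)\frac{t^n}{n!}$. $S_1(n,m)$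 are the (signed) Stirling numbers of the first kind: $x(x-1)\cdots(x-n+1)=\sum_{m=0}^nS_1(n,m)x^m$. *)

theory Defs
  imports "HOL-Analysis.Analysis" "HOL-Computational_Algebra.Computational_Algebra"
begin

(* The library's norm is confined to real vector spaces, which C_p is not; |z| is therefore
   the distance to 0, and the distance is |x - y| by a requirement in padic_complex_field. *)
definition pabs :: "'a :: {zero, metric_space} \<Rightarrow> real" where
  "pabs z = dist z 0"

(* A type whose absolute value makes it a copy of C_p: a complete, algebraically closed
   ultrametric field normalised by |p| = 1/p in which the elements algebraic over
   Q_p (the closure of the rationals) are dense, i.e. a completion of an algebraic
   closure of Q_p.  These properties determine C_p up to isometric isomorphism.
   Completeness and algebraic closedness come from the sort, and
   topology, limits and series are those of the metric. *)
definition padic_complex_field ::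
    "nat \<Rightarrow> 'a :: {alg_closed_field, field_char_0, complete_space} itself \<Rightarrow> bool" where
  "padic_complex_field p (_ :: 'a itself) \<longleftrightarrow>
     prime p \<and>
     (\<forall>x y :: 'a. dist x y = pabs (x - y)) \<and>
     (\<forall>x y :: 'a. pabs (x * y) = pabs x * pabs y) \<and>
     (\<forall>x y :: 'a. pabs (x + y) \<le> max (pabs x) (pabs y)) \<and>
     pabs (of_nat p :: 'a) = 1 / real p \<and>
     closure {z :: 'a. \<exists>P. P \<noteq> 0 \<and> (\<forall>i. coeff P i \<in> closure \<rat>) \<and> poly P z = 0} = UNIV"

(* Z_p as a subset of C_p *)
definition padic_integers :: "'a :: {ring_1, topological_space} set" where
  "padic_integers = closure \<int>"

definition exp_radius :: "nat \<Rightarrow> real" where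
  "exp_radius p = real p powr (- 1 / (real p - 1))"

definition padic_exp :: "'a :: {field_char_0, t2_space} \<Rightarrow> 'a" where
  "padic_exp x = (\<Sum>k. x ^ k / fact k)"

definition padic_log :: "'a :: {field_char_0, t2_space} \<Rightarrow> 'a" where
  "padic_log z = (\<Sum>k. (- 1) ^ k * (z - 1) ^ Suc k / of_nat (Suc k))"

definition q_power :: "'a :: {field_char_0, t2_space} \<Rightarrow> 'a \<Rightarrow> 'a" where
  "q_power q x = padic_exp (x * padic_log q)"

(* For q = 1 the quotient is read as its limit x as q tends to 1. *)
definition q_number :: "'a :: {field_char_0, t2_space} \<Rightarrow> 'a \<Rightarrow> 'a" where
  "q_number q x = (if q = 1 then x else (1 - q_power q x) / (1 - q))"

definition q_integral :: "nat \<Rightarrow> 'a :: {field_char_0, t2_space} \<Rightarrow> ('a \<Rightarrow> 'a) \<Rightarrow> 'a" where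
  "q_integral p q f =
     lim (\<lambda>N. 1 / q_number q (of_nat (p ^ N)) *
               (\<Sum>y<p ^ N. f (of_nat y) * q_power q (of_nat y)))"

(* The r-fold iterated integral of f [x_1, ..., x_r], with x_r the outermost variable *)
primrec q_multi_integral ::
    "nat \<Rightarrow> 'a :: {field_char_0, t2_space} \<Rightarrow> nat \<Rightarrow> ('a list \<Rightarrow> 'a) \<Rightarrow> 'a" where
  "q_multi_integral p q 0 f = f []"
| "q_multi_integral p q (Suc r) f =
     q_integral p q (\<lambda>y. q_multi_integral p q r (\<lambda>xs. f (xs @ [y])))"

definition carlitz_q_bernoulli ::
    "nat \<Rightarrow> 'a :: {field_char_0, t2_space} \<Rightarrow> nat \<Rightarrow> nat \<Rightarrow> 'a \<Rightarrow> 'a" where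
  "carlitz_q_bernoulli p q r m x =
     q_multi_integral p q r (\<lambda>xs. q_number q (sum_list xs + x) ^ m)"

(* (1 + lam t)^(a / lam) *)
definition degenerate_power :: "'a :: {field_char_0, t2_space} \<Rightarrow> 'a \<Rightarrow> 'a \<Rightarrow> 'a" where
  "degenerate_power lam t a = padic_exp (a / lam * padic_log (1 + lam * t))"

(* The coefficient sequence b of the generating function in t.  Besides |lam t| < p^(-1/(p-1)),
   the condition |t| < p^(-1/(p-1)) is what makes the exponential series converge at
   (a / lam) log(1 + lam t), whose absolute value is |a| |t|, for every a with |a| \<le> 1; the values
   a = [x_1 + ... + x_r + x]_q satisfy |a| \<le> 1, and for r > 0 they include a = 1.  Any
   disc around 0 determines the coefficients. *)
definition degenerate_carlitz_q_bernoulli ::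
    "nat \<Rightarrow> 'a :: {field_char_0, metric_space} \<Rightarrow> nat \<Rightarrow> nat \<Rightarrow> 'a \<Rightarrow> 'a \<Rightarrow> 'a" where
  "degenerate_carlitz_q_bernoulli p q r n x lam =
     (THE b. \<forall>t. pabs (lam * t) < exp_radius p \<and> pabs t < exp_radius p \<longrightarrow>
        (\<lambda>k. b k * (t ^ k / fact k)) sums
          q_multi_integral p q r
            (\<lambda>xs. degenerate_power lam t (q_number q (sum_list xs + x)))) n"

(* Signed: the coefficient of X^m in X (X - 1) ... (X - n + 1) *)
definition stirling1 :: "nat \<Rightarrow> nat \<Rightarrow> int" where
  "stirling1 n m = coeff (\<Prod>i<n. [:- int i, 1:]) m"

end

theory Submission
  imports Defs
begin

text \<open>
  The degenerate exponential is a binomial series,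
  \<open>(1 + \<lambda> t)^(a/\<lambda>) = \<Sum>n. a (a - \<lambda>) \<dots> (a - (n - 1) \<lambda>) t^n/n!\<close>, and expanding the falling
  factorials by Stirling numbers at \<open>a = [x\<^sub>1 + \<dots> + x\<^sub>r + x]\<^sub>q\<close> gives the claim, provided that the
  iterated integral commutes with the sum over \<open>n\<close>.

  Since \<open>|[k]\<^sub>q| = |k|\<close>, consecutive Riemann sums of a function with Lipschitz constant \<open>C\<close> differ by at
  most \<open>p C\<close>. Together with \<open>[s + y]\<^sub>q = [s]\<^sub>q + (1 + (q - 1) [s]\<^sub>q) [y]\<^sub>q\<close> this shows that integration over \<open>y\<close>
  turns a polynomial in \<open>[s + y]\<^sub>q\<close> with coefficients of absolute value at most \<open>C\<close> into a polynomial in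
  \<open>[s]\<^sub>q\<close> with coefficients of absolute value at most \<open>p C\<close>. The class of such polynomials is thus
  preserved by each of the \<open>r\<close> integrations, and the geometric decay of the \<open>n\<close>-th term of the series
  survives all of them, uniformly in the level of the Riemann sums.
\<close>

section \<open>The ultrametric absolute value\<close>

locale padic_valued_field =
  fixes p :: nat and ty :: "'a :: {field_char_0, complete_space} itself"
  assumes prime_p: "prime p"
    and dist_conv_pabs: "dist x y = pabs (x - y :: 'a)"
    and pabs_mult: "pabs (x * y :: 'a) = pabs x * pabs y"
    and pabs_add: "pabs (x + y :: 'a) \<le> max (pabs x) (pabs y)"
    and pabs_p: "pabs (of_nat p :: 'a) = 1 / real p"
begin

abbreviation \<rho> :: real where "\<rho> \<equiv> exp_radius p"

lemma pabs_nonneg [simp]: "0 \<le> pabs (x :: 'a)"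
  by (simp add: pabs_def)

lemma pabs_eq_0_iff [simp]: "pabs (x :: 'a) = 0 \<longleftrightarrow> x = 0"
  by (simp add: pabs_def)

lemma pabs_0 [simp]: "pabs (0 :: 'a) = 0"
  by simp

lemma pabs_pos: "x \<noteq> 0 \<Longrightarrow> 0 < pabs (x :: 'a)"
  using pabs_nonneg[of x] pabs_eq_0_iff[of x] by linarith

lemma pabs_1 [simp]: "pabs (1 :: 'a) = 1"
  using pabs_mult[of 1 1] pabs_eq_0_iff[of 1] by auto

lemma pabs_minus [simp]: "pabs (- x :: 'a) = pabs x"
  using dist_conv_pabs[of 0 x] by (simp add: pabs_def dist_commute)

lemma pabs_diff: "pabs (x - y :: 'a) \<le> max (pabs x) (pabs y)"
  using pabs_add[of x "- y"] by simp

lemma pabs_diff_commute: "pabs (x - y :: 'a) = pabs (y - x)"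
  using pabs_minus[of "x - y"] by simp

lemma pabs_power: "pabs (x ^ n :: 'a) = pabs x ^ n"
  by (induction n) (auto simp: pabs_mult)

lemma pabs_divide: "pabs (x / y :: 'a) = pabs x / pabs y"
proof (cases "y = 0")
  case False
  then show ?thesis
    using pabs_mult[of "x / y" y] by (simp add: field_simps)
qed auto

lemma pabs_add_le: "\<lbrakk>pabs x \<le> C; pabs y \<le> C\<rbrakk> \<Longrightarrow> pabs (x + y :: 'a) \<le> C"
  using pabs_add[of x y] by linarith

lemma pabs_diff_le: "\<lbrakk>pabs x \<le> C; pabs y \<le> C\<rbrakk> \<Longrightarrow> pabs (x - y :: 'a) \<le> C"
  using pabs_diff[of x y] by linarith

lemma pabs_le_imp_nonneg: "pabs (x :: 'a) \<le> C \<Longrightarrow> 0 \<le> C"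
  by (rule order_trans[OF pabs_nonneg])

lemma pabs_mult_le: "\<lbrakk>pabs x \<le> C; pabs y \<le> D\<rbrakk> \<Longrightarrow> pabs (x * y :: 'a) \<le> C * D"
  unfolding pabs_mult by (intro mult_mono pabs_nonneg pabs_le_imp_nonneg)

lemma pabs_mult_le_1: "\<lbrakk>pabs x \<le> 1; pabs y \<le> C\<rbrakk> \<Longrightarrow> pabs (x * y :: 'a) \<le> C"
  using pabs_mult_le[of x 1 y C] by simp

lemma pabs_power_le_1: "pabs x \<le> 1 \<Longrightarrow> pabs (x ^ n :: 'a) \<le> 1"
  by (simp add: pabs_power power_le_one)

lemma pabs_sum_le:
  assumes "0 \<le> C" "\<And>i. i \<in> A \<Longrightarrow> pabs (f i :: 'a) \<le> C"
  shows "pabs (sum f A) \<le> C"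
  using assms(2)
proof (induction A rule: infinite_finite_induct)
  case (insert i A)
  then show ?case by (simp add: pabs_add_le)
qed (use assms(1) in auto)

lemma pabs_of_nat_le_1: "pabs (of_nat n :: 'a) \<le> 1"
  by (induction n) (auto intro!: pabs_add_le)

lemma pabs_of_int_le_1: "pabs (of_int n :: 'a) \<le> 1"
  by (cases n) (use pabs_of_nat_le_1 in \<open>auto simp del: of_nat_Suc\<close>)

text \<open>Ultrametric triangles are isosceles: \<open>x\<close> is the difference of
  \<open>x + y\<close> and \<open>y\<close>, and \<open>y\<close> is too small to attain the
  maximum.\<close>

lemma pabs_add_eq:
  assumes "pabs y < pabs (x :: 'a)"
  shows "pabs (x + y) = pabs x"
proof (rule antisym)
  show "pabs (x + y) \<le> pabs x" using assms by (intro pabs_add_le) auto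
  show "pabs x \<le> pabs (x + y)" using pabs_diff[of "x + y" y] assms by auto
qed

section \<open>Absolute values of integers and factorials\<close>

lemma p_gt_1: "p > 1"
  using prime_p prime_gt_1_nat by blast

text \<open>In a Bezout identity \<open>u * n + v * p = 1\<close> the second summand has absolute
  value at most \<open>1 / p\<close>, so the first has to supply the value 1.\<close>

lemma pabs_of_nat_eq_1:
  assumes "\<not> p dvd n"
  shows "pabs (of_nat n :: 'a) = 1"
proof -
  have "coprime (int n) (int p)"
    using assms prime_p by (metis coprime_commute coprime_int_iff prime_imp_coprime)
  then obtain u v where uv: "u * int n + v * int p = 1"
    using coprime_iff_gcd_eq_1[of "int n" "int p"] bezout_int[of "int n" "int p"] by auto
  have "(of_int u * of_nat n + of_int v * of_nat p :: 'a) = of_int (u * int n + v * int p)"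
    by simp
  also have "\<dots> = 1" by (simp only: uv of_int_1)
  finally have "1 = pabs (of_int u * of_nat n + of_int v * of_nat p :: 'a)" by simp
  also have "\<dots> \<le> max (pabs (of_int u * of_nat n :: 'a)) (pabs (of_int v * of_nat p :: 'a))"
    by (rule pabs_add)
  also have "\<dots> \<le> max (pabs (of_nat n :: 'a)) (1 / real p)"
    by (intro max.mono pabs_mult_le_1 pabs_of_int_le_1) (simp_all add: pabs_p)
  finally have "1 \<le> pabs (of_nat n :: 'a)"
    using p_gt_1 by (auto simp: le_max_iff_disj)
  with pabs_of_nat_le_1[of n] show ?thesis by simp
qed

text \<open>One step of Legendre's formula: only the \<open>n div p\<close> multiples of
  \<open>p\<close> among the factors matter, and taking one \<open>p\<close> out of each of them
  leaves the factorial of \<open>n div p\<close>.\<close>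

lemma pabs_fact_rec:
  "pabs (fact n :: 'a) = (1 / real p) ^ (n div p) * pabs (fact (n div p) :: 'a)"
proof (induction n)
  case (Suc n)
  show ?case
  proof (cases "p dvd Suc n")
    case True
    then have d: "Suc n div p = Suc (n div p)"
      using p_gt_1 by (simp add: div_Suc dvd_eq_mod_eq_0)
    have "of_nat (Suc n) = (of_nat p * of_nat (Suc (n div p)) :: 'a)"
      using True d by (metis dvd_mult_div_cancel of_nat_mult)
    then have "pabs (of_nat (Suc n) :: 'a) = 1 / real p * pabs (of_nat (Suc (n div p)) :: 'a)"
      by (simp only: pabs_mult pabs_p)
    then show ?thesis
      using Suc by (simp add: d pabs_mult del: of_nat_Suc)
  next
    case False
    then have "Suc n div p = n div p"
      using p_gt_1 by (simp add: div_Suc dvd_eq_mod_eq_0)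
    then show ?thesis
      using Suc pabs_of_nat_eq_1[OF False] by (simp add: pabs_mult del: of_nat_Suc)
  qed
qed auto

lemma exp_radius_pos [simp]: "0 < \<rho>"
  using p_gt_1 by (simp add: exp_radius_def)

lemma exp_radius_less_1: "\<rho> < 1"
  using p_gt_1 by (simp add: exp_radius_def powr_less_one)

lemma exp_radius_power: "\<rho> ^ (p - 1) = 1 / real p"
proof -
  have "\<rho> ^ (p - 1) = real p powr (- 1 / (real p - 1) * real (p - 1))"
    using powr_realpow[OF exp_radius_pos, of "p - 1"] by (simp add: exp_radius_def powr_powr)
  also have "\<dots> = real p powr (- 1)"
    using p_gt_1 by (simp add: of_nat_diff)
  finally show ?thesis using p_gt_1 by (simp add: powr_minus_divide)
qed

text \<open>Legendre's bound \<open>(n - 1) / (p - 1)\<close> for the exponent of \<open>p\<close>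
  in \<open>fact n\<close>, written multiplicatively: each \<open>1 / p\<close> from
  \<open>pabs_fact_rec\<close> is worth \<open>p - 1\<close> factors \<open>\<rho>\<close>. The
  spare \<open>\<rho>\<close> on the right later lets the linear terms of exponential and logarithm
  dominate.\<close>

lemma exp_radius_power_le_fact:
  "n > 0 \<Longrightarrow> \<rho> ^ n \<le> \<rho> * pabs (fact n :: 'a)"
proof (induction n rule: less_induct)
  case (less n)
  define m where "m = n div p"
  have fact_n: "pabs (fact n :: 'a) = (1 / real p) ^ m * pabs (fact m :: 'a)"
    unfolding m_def by (rule pabs_fact_rec)
  show ?case
  proof (cases "m = 0")
    case True
    then show ?thesis
      using fact_n less.prems exp_radius_less_1
        power_decreasing[of 1 n \<rho>] by (simp add: less_imp_le)
  next
    case False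
    have "m < n" using less.prems p_gt_1 by (simp add: m_def)
    have "\<rho> ^ n \<le> \<rho> ^ ((p - 1) * m + m)"
    proof (rule power_decreasing)
      have "(p - 1) * m + m = p * m" using p_gt_1 by (simp add: algebra_simps)
      then show "(p - 1) * m + m \<le> n" by (simp add: m_def)
    qed (use exp_radius_less_1 in \<open>auto intro: less_imp_le\<close>)
    also have "\<dots> = (1 / real p) ^ m * \<rho> ^ m"
      by (simp only: power_add power_mult exp_radius_power)
    also have "\<dots> \<le> (1 / real p) ^ m * (\<rho> * pabs (fact m :: 'a))"
      using less.IH[OF \<open>m < n\<close>] False by (intro mult_left_mono) auto
    finally show ?thesis by (simp add: fact_n mult_ac)
  qed
qed

lemma inverse_fact_le: "n > 0 \<Longrightarrow> 1 / pabs (fact n :: 'a) \<le> \<rho> / \<rho> ^ n"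
  using exp_radius_power_le_fact[of n] pabs_pos[of "fact n"] by (simp add: field_simps)

lemma inverse_fact_le': "1 / pabs (fact n :: 'a) \<le> 1 / \<rho> ^ n"
proof (cases "n > 0")
  case True
  have "\<rho> / \<rho> ^ n \<le> 1 / \<rho> ^ n"
    using exp_radius_less_1 less_imp_le[OF exp_radius_pos]
    by (intro divide_right_mono zero_le_power) auto
  with inverse_fact_le[OF True] show ?thesis by linarith
qed auto

text \<open>Since \<open>n\<close> divides \<open>fact n\<close>, its absolute value is at least
  that of \<open>fact n\<close>; the logarithm thus obeys the same estimates as the
  exponential.\<close>

lemma inverse_of_nat_le: "n > 0 \<Longrightarrow> 1 / pabs (of_nat n :: 'a) \<le> \<rho> / \<rho> ^ n"
proof -
  assume n: "n > 0"
  have "pabs (fact n :: 'a) \<le> pabs (of_nat n :: 'a)"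
    using n pabs_mult_le[OF order_refl pabs_of_nat_le_1, of "of_nat n" "fact (n - 1)"]
    by (simp add: fact_reduce[of n])
  then have "1 / pabs (of_nat n :: 'a) \<le> 1 / pabs (fact n :: 'a)"
    using n by (intro divide_left_mono mult_pos_pos pabs_pos) auto
  with inverse_fact_le[OF n] show ?thesis by linarith
qed

subsection \<open>Limits and series\<close>

text \<open>The sort of \<open>'a\<close> does not tie the metric to the field operations, so the
  limit rules below are obtained from real limits of absolute values.\<close>

lemma tendsto_iff_pabs: "(f \<longlongrightarrow> (l :: 'a)) F \<longleftrightarrow> ((\<lambda>x. pabs (f x - l)) \<longlongrightarrow> 0) F"
  by (subst tendsto_dist_iff) (simp add: dist_conv_pabs)

lemma tendsto_pabs_bound:
  assumes "\<And>n. pabs (f n - l :: 'a) \<le> g n" "g \<longlonglongrightarrow> 0"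
  shows "f \<longlonglongrightarrow> l"
  unfolding tendsto_iff_pabs
  by (rule tendsto_sandwich[of "\<lambda>_. 0", OF _ _ tendsto_const assms(2)]) (use assms(1) in auto)

lemma tendsto_add_pabs:
  assumes "f \<longlonglongrightarrow> (l :: 'a)" "g \<longlonglongrightarrow> m"
  shows "(\<lambda>n. f n + g n) \<longlonglongrightarrow> l + m"
proof (rule tendsto_pabs_bound)
  fix n
  have eq: "f n + g n - (l + m) = (f n - l) + (g n - m)" by simp
  show "pabs (f n + g n - (l + m)) \<le> pabs (f n - l) + pabs (g n - m)"
    unfolding eq
    using pabs_add[of "f n - l" "g n - m"] pabs_nonneg[of "f n - l"] pabs_nonneg[of "g n - m"]
    by linarith
  show "(\<lambda>n. pabs (f n - l) + pabs (g n - m)) \<longlonglongrightarrow> 0"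
    using assms unfolding tendsto_iff_pabs by (intro tendsto_add_zero) auto
qed

lemma tendsto_cmult_pabs:
  assumes "f \<longlonglongrightarrow> (l :: 'a)"
  shows "(\<lambda>n. c * f n) \<longlonglongrightarrow> c * l"
proof (rule tendsto_pabs_bound)
  show "pabs (c * f n - c * l) \<le> pabs c * pabs (f n - l)" for n
    by (simp flip: pabs_mult right_diff_distrib)
  show "(\<lambda>n. pabs c * pabs (f n - l)) \<longlonglongrightarrow> 0"
    using assms unfolding tendsto_iff_pabs by (intro tendsto_mult_right_zero)
qed

lemma tendsto_sum_pabs:
  assumes "\<And>i. i \<in> A \<Longrightarrow> (\<lambda>n. f i n) \<longlonglongrightarrow> (l i :: 'a)"
  shows "(\<lambda>n. \<Sum>i\<in>A. f i n) \<longlonglongrightarrow> (\<Sum>i\<in>A. l i)"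
  using assms
  by (induction A rule: infinite_finite_induct) (auto intro!: tendsto_add_pabs)

lemma pabs_le_lim:
  assumes "f \<longlonglongrightarrow> (l :: 'a)" "\<And>n. pabs (f n) \<le> C"
  shows "pabs l \<le> C"
proof -
  have "pabs l \<le> C + pabs (f n - l)" for n
  proof -
    have "pabs l \<le> max (pabs (f n)) (pabs (f n - l))"
      using pabs_diff[of "f n" "f n - l"] by simp
    then show ?thesis
      using assms(2)[of n] pabs_le_imp_nonneg[OF assms(2)] pabs_nonneg[of "f n - l"] by linarith
  qed
  moreover have "(\<lambda>n. C + pabs (f n - l)) \<longlonglongrightarrow> C + 0"
    using assms(1) unfolding tendsto_iff_pabs by (intro tendsto_add tendsto_const)
  ultimately have "pabs l \<le> C + 0" by (intro LIMSEQ_le_const[of _ "C + 0"]) auto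
  then show ?thesis by simp
qed

text \<open>In an ultrametric space consecutive differences decide: \<open>f n - f N\<close>
  telescopes, and a sum of steps is no larger than the largest step. Completeness does the
  rest.\<close>

lemma convergent_pabs:
  assumes "(\<lambda>n. pabs (f (Suc n) - f n :: 'a)) \<longlonglongrightarrow> 0"
  shows "convergent f"
proof -
  have "Cauchy f"
  proof (rule metric_CauchyI)
    fix e :: real assume "e > 0"
    then have "\<forall>\<^sub>F n in sequentially. pabs (f (Suc n) - f n) < e / 2"
      by (intro order_tendstoD(2)[OF assms]) simp
    then obtain N where N: "pabs (f (Suc n) - f n) < e / 2" if "n \<ge> N" for n
      unfolding eventually_sequentially by blast
    have *: "pabs (f n - f N) \<le> e / 2" if "n \<ge> N" for n
      using that
    proof (induction n rule: dec_induct)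
      case (step n)
      have "pabs ((f (Suc n) - f n) + (f n - f N)) \<le> e / 2"
        using step N[of n] by (intro pabs_add_le) auto
      then show ?case by simp
    qed (use \<open>e > 0\<close> in auto)
    have "dist (f m) (f n) < e" if "m \<ge> N" "n \<ge> N" for m n
    proof -
      have "pabs ((f m - f N) - (f n - f N)) \<le> e / 2"
        using that by (intro pabs_diff_le *)
      then show ?thesis using \<open>e > 0\<close> by (simp add: dist_conv_pabs)
    qed
    then show "\<exists>M. \<forall>m\<ge>M. \<forall>n\<ge>M. dist (f m) (f n) < e" by blast
  qed
  then show ?thesis by (simp add: Cauchy_convergent_iff)
qed

lemma summable_pabs:
  assumes "(\<lambda>n. pabs (f n :: 'a)) \<longlonglongrightarrow> 0"
  shows "summable f"
  using convergent_pabs[of "\<lambda>n. \<Sum>i<n. f i"] assms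
  by (simp add: summable_iff_convergent)

lemma summable_geometric_bound:
  assumes "\<And>n. pabs (f n :: 'a) \<le> C * \<theta> ^ n" "0 \<le> \<theta>" "\<theta> < 1"
  shows "summable f"
proof (rule summable_pabs)
  have "(\<lambda>n. C * \<theta> ^ n) \<longlonglongrightarrow> 0"
    using assms by (intro tendsto_mult_right_zero LIMSEQ_realpow_zero) auto
  then show "(\<lambda>n. pabs (f n)) \<longlonglongrightarrow> 0"
    using tendsto_pabs_bound[of f 0 "\<lambda>n. C * \<theta> ^ n"] assms(1)
    unfolding tendsto_iff_pabs by simp
qed

lemma sums_cmult_pabs: "f sums (l :: 'a) \<Longrightarrow> (\<lambda>n. c * f n) sums (c * l)"
  unfolding sums_def by (subst sum_distrib_left[symmetric]) (rule tendsto_cmult_pabs)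

lemma sums_add_pabs: "\<lbrakk>f sums (l :: 'a); g sums m\<rbrakk> \<Longrightarrow> (\<lambda>n. f n + g n) sums (l + m)"
  unfolding sums_def by (subst sum.distrib) (rule tendsto_add_pabs)

lemma sums_diff_pabs: "\<lbrakk>f sums (l :: 'a); g sums m\<rbrakk> \<Longrightarrow> (\<lambda>n. f n - g n) sums (l - m)"
  using sums_add_pabs[of f l "\<lambda>n. (- 1) * g n" "(- 1) * m"] sums_cmult_pabs[of g m "- 1"]
  by simp

lemma sums_sum_pabs:
  assumes "\<And>i. i \<in> A \<Longrightarrow> f i sums (l i :: 'a)"
  shows "(\<lambda>n. \<Sum>i\<in>A. f i n) sums (\<Sum>i\<in>A. l i)"
  using assms
  by (induction A rule: infinite_finite_induct) (auto intro!: sums_add_pabs)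

lemma sums_tail_le:
  assumes "f sums (l :: 'a)" "\<And>n. n \<ge> K \<Longrightarrow> pabs (f n) \<le> C" "0 \<le> C"
  shows "pabs (l - (\<Sum>n<K. f n)) \<le> C"
proof (rule pabs_le_lim)
  have "(\<lambda>n. (\<Sum>i<n + K. f i) + (- 1) * (\<Sum>n<K. f n)) \<longlonglongrightarrow> l + (- 1) * (\<Sum>n<K. f n)"
    using assms(1) unfolding sums_def
    by (intro tendsto_add_pabs tendsto_const LIMSEQ_ignore_initial_segment)
  then show "(\<lambda>n. (\<Sum>i<n + K. f i) - (\<Sum>n<K. f n)) \<longlonglongrightarrow> l - (\<Sum>n<K. f n)" by simp
  show "pabs ((\<Sum>i<n + K. f i) - (\<Sum>n<K. f n)) \<le> C" for n
  proof -
    have "(\<Sum>i<n + K. f i) - (\<Sum>n<K. f n) = sum f {K..<n + K}"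
      using sum_diff_nat_ivl[of 0 K "n + K" f] by (simp add: atLeast0LessThan)
    also have "pabs \<dots> \<le> C" by (rule pabs_sum_le) (use assms in auto)
    finally show ?thesis .
  qed
qed

lemma pabs_sums_le:
  assumes "f sums (l :: 'a)" "\<And>n. pabs (f n) \<le> C"
  shows "pabs l \<le> C"
  using sums_tail_le[OF assms(1), of 0 C] assms(2) pabs_le_imp_nonneg[OF assms(2)] by simp

lemma sums_split_first:
  assumes "f sums (l :: 'a)"
  shows "(\<lambda>n. f (Suc n)) sums (l - f 0)"
proof -
  have "(\<lambda>n. (\<Sum>i<Suc n. f i) + (- 1) * f 0) \<longlonglongrightarrow> l + (- 1) * f 0"
    using assms unfolding sums_def by (intro tendsto_add_pabs tendsto_const LIMSEQ_Suc)
  then show ?thesis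
    unfolding sums_def by (simp add: sum.lessThan_Suc_shift del: sum.lessThan_Suc)
qed

text \<open>The summand vanishes below the diagonal, so the difference between the two iterated
  partial sums consists of row tails only.\<close>

lemma sums_triangle_swap:
  fixes a :: "nat \<Rightarrow> nat \<Rightarrow> 'a"
  assumes bound: "\<And>k n. pabs (a k n) \<le> C * \<theta> ^ n" and \<theta>: "0 \<le> \<theta>" "\<theta> < 1"
    and zero: "\<And>k n. n < k \<Longrightarrow> a k n = 0"
    and rows: "\<And>k. a k sums r k"
    and cols: "(\<lambda>n. \<Sum>k\<le>n. a k n) sums l"
  shows "r sums l"
proof -
  have C: "0 \<le> C" using pabs_le_imp_nonneg[OF bound[of 0 0]] by simp
  have eq: "(\<Sum>n<K. \<Sum>k\<le>n. a k n) = (\<Sum>k<K. \<Sum>n<K. a k n)" for K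
  proof -
    have "(\<Sum>n<K. \<Sum>k\<le>n. a k n) = (\<Sum>n<K. \<Sum>k<K. a k n)"
      by (rule sum.cong[OF refl], rule sum.mono_neutral_left) (auto simp: zero)
    also have "\<dots> = (\<Sum>k<K. \<Sum>n<K. a k n)" by (rule sum.swap)
    finally show ?thesis .
  qed
  have diff: "pabs ((\<Sum>k<K. r k) - (\<Sum>n<K. \<Sum>k\<le>n. a k n)) \<le> C * \<theta> ^ K" for K
  proof -
    have "pabs (r k - (\<Sum>n<K. a k n)) \<le> C * \<theta> ^ K" for k
    proof (rule sums_tail_le[OF rows])
      fix n assume "n \<ge> K"
      then have "\<theta> ^ n \<le> \<theta> ^ K" using \<theta> by (intro power_decreasing) auto
      then show "pabs (a k n) \<le> C * \<theta> ^ K"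
        using bound[of k n] C by (meson mult_left_mono order_trans)
    qed (use C \<theta> in auto)
    then show ?thesis
      using C \<theta> unfolding eq sum_subtractf[symmetric] by (intro pabs_sum_le) auto
  qed
  have "(\<lambda>K. C * \<theta> ^ K) \<longlonglongrightarrow> 0"
    using \<theta> by (intro tendsto_mult_right_zero LIMSEQ_realpow_zero) auto
  then have "(\<lambda>K. (\<Sum>k<K. r k) - (\<Sum>n<K. \<Sum>k\<le>n. a k n)) \<longlonglongrightarrow> 0"
    by (rule tendsto_pabs_bound[rotated]) (simp add: diff)
  from tendsto_add_pabs[OF this cols[unfolded sums_def]] show ?thesis
    by (simp add: sums_def)
qed

text \<open>The geometric bound does not depend on \<open>N\<close>, so all tails beyond some
  \<open>K\<close> are below \<open>e\<close> at once, and finitely many termwise limits remain.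
  Convergence of \<open>s\<close> is part of the conclusion because an integral defined by
  \<open>lim\<close> is meaningful only once the limit is known to exist.\<close>

lemma sums_uniform_limit:
  fixes a :: "nat \<Rightarrow> nat \<Rightarrow> 'a"
  assumes bound: "\<And>N n. pabs (a N n) \<le> C * \<theta> ^ n" and \<theta>: "0 \<le> \<theta>" "\<theta> < 1"
    and sums: "\<And>N. a N sums s N"
    and lim: "\<And>n. (\<lambda>N. a N n) \<longlonglongrightarrow> b n"
  shows "\<exists>l. s \<longlonglongrightarrow> l \<and> b sums l"
proof -
  have C: "0 \<le> C" using pabs_le_imp_nonneg[OF bound[of 0 0]] by simp
  have boundb: "pabs (b n) \<le> C * \<theta> ^ n" for n
    by (rule pabs_le_lim[OF lim]) (rule bound)
  then obtain l where l: "b sums l"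
    using summable_geometric_bound[of b C \<theta>] \<theta> by (auto simp: summable_def)
  have tail: "C * \<theta> ^ n \<le> C * \<theta> ^ K" if "n \<ge> K" for n K
    using \<theta> C that by (intro mult_left_mono power_decreasing) auto
  have "s \<longlonglongrightarrow> l"
    unfolding tendsto_iff_pabs
  proof (rule order_tendstoI)
    fix e :: real assume "e < 0"
    then show "\<forall>\<^sub>F N in sequentially. e < pabs (s N - l)"
      by (intro always_eventually allI) (rule less_le_trans[OF _ pabs_nonneg])
  next
    fix e :: real assume e: "e > 0"
    have "(\<lambda>K. C * \<theta> ^ K) \<longlonglongrightarrow> 0"
      using \<theta> by (intro tendsto_mult_right_zero LIMSEQ_realpow_zero) auto
    from order_tendstoD(2)[OF this e] obtain K where K: "C * \<theta> ^ K < e"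
      unfolding eventually_sequentially by blast
    have "(\<lambda>N. \<Sum>n<K. a N n) \<longlonglongrightarrow> (\<Sum>n<K. b n)"
      by (intro tendsto_sum_pabs lim)
    from order_tendstoD(2)[OF this[unfolded tendsto_iff_pabs] e]
    obtain M where M: "pabs ((\<Sum>n<K. a N n) - (\<Sum>n<K. b n)) < e" if "N \<ge> M" for N
      unfolding eventually_sequentially by blast
    have "pabs (s N - l) < e" if "N \<ge> M" for N
    proof -
      have 1: "pabs (s N - (\<Sum>n<K. a N n)) \<le> C * \<theta> ^ K"
        by (rule sums_tail_le[OF sums order_trans[OF bound tail]]) (use C \<theta> in auto)
      have 2: "pabs (l - (\<Sum>n<K. b n)) \<le> C * \<theta> ^ K"
        by (rule sums_tail_le[OF l order_trans[OF boundb tail]]) (use C \<theta> in auto)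
      have "s N - l = ((s N - (\<Sum>n<K. a N n)) - (l - (\<Sum>n<K. b n)))
          + ((\<Sum>n<K. a N n) - (\<Sum>n<K. b n))"
        by simp
      also have "pabs \<dots> < e"
        using 1 2 M[OF that] K
          pabs_diff[of "s N - (\<Sum>n<K. a N n)" "l - (\<Sum>n<K. b n)"]
          pabs_add[of "(s N - (\<Sum>n<K. a N n)) - (l - (\<Sum>n<K. b n))"
            "(\<Sum>n<K. a N n) - (\<Sum>n<K. b n)"]
        by linarith
      finally show ?thesis .
    qed
    then show "\<forall>\<^sub>F N in sequentially. pabs (s N - l) < e"
      unfolding eventually_sequentially by blast
  qed
  with l show ?thesis by blast
qed

text \<open>The products form a triangular array with \<open>f i * g (n - i)\<close> in row
  \<open>i\<close> and column \<open>n\<close>. Row \<open>i\<close> sums to \<open>f i * t\<close>,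
  and \<open>sums_triangle_swap\<close> equates the total over columns with the total over
  rows.\<close>

lemma sums_Cauchy_product:
  fixes f g :: "nat \<Rightarrow> 'a"
  assumes f: "f sums s" "\<And>n. pabs (f n) \<le> C * \<theta> ^ n"
    and g: "g sums t" "\<And>n. pabs (g n) \<le> D * \<theta> ^ n"
    and \<theta>: "0 \<le> \<theta>" "\<theta> < 1"
  shows "(\<lambda>n. \<Sum>i\<le>n. f i * g (n - i)) sums (s * t)"
proof -
  define a where "a i n = (if i \<le> n then f i * g (n - i) else 0)" for i n
  have C: "0 \<le> C" using pabs_le_imp_nonneg[OF f(2)[of 0]] by simp
  have D: "0 \<le> D" using pabs_le_imp_nonneg[OF g(2)[of 0]] by simp
  have bound: "pabs (a i n) \<le> C * D * \<theta> ^ n" for i n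
  proof (cases "i \<le> n")
    case True
    have "pabs (f i * g (n - i)) \<le> (C * \<theta> ^ i) * (D * \<theta> ^ (n - i))"
      by (intro pabs_mult_le f g)
    also have "\<dots> = C * D * \<theta> ^ n"
      using True by (simp add: power_add[symmetric])
    finally show ?thesis using True by (simp add: a_def)
  qed (use C D \<theta> in \<open>auto simp: a_def\<close>)
  have cols_eq: "(\<Sum>i\<le>n. a i n) = (\<Sum>i\<le>n. f i * g (n - i))" for n
    by (simp add: a_def)
  have "summable (\<lambda>n. \<Sum>i\<le>n. a i n)"
    by (rule summable_geometric_bound[of _ "C * D" \<theta>])
       (use bound C D \<theta> in \<open>auto intro!: pabs_sum_le\<close>)
  then obtain l where l: "(\<lambda>n. \<Sum>i\<le>n. a i n) sums l" by (auto simp: summable_def)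
  have rows: "a i sums (f i * t)" for i
  proof -
    have "(\<lambda>K. f i * (\<Sum>j<K - i. g j)) \<longlonglongrightarrow> f i * t"
      using g(1) unfolding sums_def
      by (intro tendsto_cmult_pabs filterlim_compose[OF _ filterlim_minus_const_nat_at_top])
    \<comment> \<open>For \<open>K \<le> i\<close> the truncated difference \<open>K - i\<close> is
      0 and both sides vanish.\<close>
    moreover have "f i * (\<Sum>j<K - i. g j) = (\<Sum>n<K. a i n)" for K
    proof -
      have "(\<Sum>n<K. a i n) = (\<Sum>n=i..<K. f i * g (n - i))"
        by (rule sum.mono_neutral_cong_right) (auto simp: a_def)
      also have "\<dots> = (\<Sum>j<K - i. f i * g j)"
        by (rule sum.reindex_bij_witness[of _ "\<lambda>j. j + i" "\<lambda>n. n - i"]) auto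
      finally show ?thesis by (simp add: sum_distrib_left)
    qed
    ultimately show ?thesis by (simp add: sums_def)
  qed
  have "(\<lambda>i. f i * t) sums l"
    by (rule sums_triangle_swap[OF bound \<theta> _ rows l]) (simp add: a_def)
  moreover have "(\<lambda>i. f i * t) sums (s * t)"
    using sums_cmult_pabs[OF f(1), of t] by (simp add: mult.commute)
  ultimately have "l = s * t" by (rule sums_unique2)
  then show ?thesis using l by (simp add: cols_eq)
qed

end

section \<open>The binomial series as the exponential of a logarithm\<close>

lemma fps_exp_compose_ln: "fps_exp (c :: 'a :: field_char_0) oo fps_ln 1 = fps_binomial c"
proof -
  \<comment> \<open>\<open>fps_ln 1\<close> is the series of \<open>log (1 + X)\<close>. The
    composite solves \<open>(1 + X) F' = c F\<close> with \<open>F(0) = 1\<close>, which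
    characterises the binomial series.\<close>
  have "fps_deriv (fps_exp c oo fps_ln 1)
      = fps_const c * (fps_exp c oo fps_ln 1) * inverse (1 + fps_X)"
    by (simp add: fps_compose_deriv fps_ln_deriv fps_compose_mult_distrib)
  then have "fps_deriv (fps_exp c oo fps_ln 1) = fps_const c * (fps_exp c oo fps_ln 1) / (1 + fps_X)"
    by (simp add: fps_divide_unit)
  then show ?thesis
    by (subst fps_binomial_ODE_unique'[symmetric]) (simp add: fps_compose_nth_0)
qed

context padic_valued_field
begin

lemma pabs_fps_ln_nth:
  "pabs (fps_ln 1 $ n :: 'a) \<le> \<rho> / \<rho> ^ n"
  using inverse_of_nat_le[of n] less_imp_le[OF exp_radius_pos]
  by (cases "n = 0") (auto simp: fps_ln_nth pabs_divide pabs_power)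

text \<open>Each logarithm contributes a factor \<open>\<rho>\<close>; the resulting
  \<open>\<rho> ^ k\<close> will cancel the growth of \<open>1 / fact k\<close> in the exponential
  series.\<close>

lemma pabs_fps_ln_power_nth:
  "pabs ((fps_ln 1 ^ k) $ n :: 'a) \<le> \<rho> ^ k / \<rho> ^ n"
proof (induction k arbitrary: n)
  case 0
  then show ?case using less_imp_le[OF exp_radius_pos] by simp
next
  case (Suc k)
  have "pabs (fps_ln 1 $ i * (fps_ln 1 ^ k) $ (n - i) :: 'a) \<le> \<rho> ^ Suc k / \<rho> ^ n"
    if "i \<le> n" for i
  proof -
    have "pabs (fps_ln 1 $ i * (fps_ln 1 ^ k) $ (n - i) :: 'a)
        \<le> (\<rho> / \<rho> ^ i) * (\<rho> ^ k / \<rho> ^ (n - i))"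
      by (intro pabs_mult_le pabs_fps_ln_nth Suc)
    also have "\<dots> = \<rho> ^ Suc k / (\<rho> ^ i * \<rho> ^ (n - i))" by simp
    also have "\<rho> ^ i * \<rho> ^ (n - i) = \<rho> ^ n"
      using that by (simp flip: power_add)
    finally show ?thesis .
  qed
  then show ?case
    using less_imp_le[OF exp_radius_pos] by (auto simp: fps_mult_nth intro!: pabs_sum_le)
qed

lemma pabs_fps_ln_power_term:
  "pabs ((fps_ln 1 ^ k) $ n * z ^ n :: 'a) \<le> \<rho> ^ k * (pabs z / \<rho>) ^ n"
  using pabs_mult_le[OF pabs_fps_ln_power_nth order_refl, of k n "z ^ n"]
  by (simp add: pabs_power power_divide)

lemma radius_quotient_less_1: "r < \<rho> \<Longrightarrow> r / \<rho> < 1"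
  using exp_radius_pos by (simp add: divide_less_eq)

lemma padic_log_sums:
  assumes z: "pabs (z :: 'a) < \<rho>"
  shows "(\<lambda>n. fps_ln 1 $ n * z ^ n) sums padic_log (1 + z)"
proof -
  have "summable (\<lambda>n. fps_ln 1 $ n * z ^ n)"
    by (rule summable_geometric_bound[of _ \<rho> "pabs z / \<rho>"])
       (use pabs_fps_ln_power_term[of 1 _ z] radius_quotient_less_1[OF z]
          less_imp_le[OF exp_radius_pos] in auto)
  then obtain l where l: "(\<lambda>n. fps_ln 1 $ n * z ^ n) sums l"
    by (auto simp: summable_def)
  \<comment> \<open>\<open>padic_log\<close> starts with the linear term, so the zero constant
    coefficient of \<open>fps_ln 1\<close> is split off.\<close>
  from sums_split_first[OF l] have "(\<lambda>k. (- 1) ^ k * z ^ Suc k / of_nat (Suc k)) sums l"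
    by (simp add: fps_ln_nth)
  then have "padic_log (1 + z) = l"
    unfolding padic_log_def by (simp add: sums_iff)
  with l show ?thesis by simp
qed

lemma padic_log_power_sums:
  assumes z: "pabs (z :: 'a) < \<rho>"
  shows "(\<lambda>n. (fps_ln 1 ^ k) $ n * z ^ n) sums padic_log (1 + z) ^ k"
proof (induction k)
  case 0
  have "(\<lambda>n. 1 $ n * z ^ n) sums (\<Sum>n\<in>{0}. 1 $ n * z ^ n)"
    by (rule sums_finite) auto
  then show ?case by simp
next
  case (Suc k)
  have "(\<lambda>n. \<Sum>i\<le>n. (fps_ln 1 $ i * z ^ i) * ((fps_ln 1 ^ k) $ (n - i) * z ^ (n - i)))
      sums (padic_log (1 + z) * padic_log (1 + z) ^ k)"
    by (rule sums_Cauchy_product[OF padic_log_sums[OF z] _ Suc pabs_fps_ln_power_term, of \<rho>])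
       (use pabs_fps_ln_power_term[of 1 _ z] radius_quotient_less_1[OF z]
          less_imp_le[OF exp_radius_pos] in auto)
  moreover have "(\<Sum>i\<le>n. (fps_ln 1 $ i * z ^ i) * ((fps_ln 1 ^ k) $ (n - i) * z ^ (n - i)))
      = (fps_ln 1 ^ Suc k) $ n * z ^ n" for n
  proof -
    have "(fps_ln 1 $ i * z ^ i) * ((fps_ln 1 ^ k) $ (n - i) * z ^ (n - i))
        = fps_ln 1 $ i * (fps_ln 1 ^ k) $ (n - i) * z ^ n" if "i \<le> n" for i
    proof -
      have "z ^ i * z ^ (n - i) = z ^ n" using that by (simp flip: power_add)
      then show ?thesis by (metis (no_types, lifting) mult.assoc mult.commute)
    qed
    then show ?thesis
      unfolding power_Suc fps_mult_nth sum_distrib_right atLeast0AtMost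
      by (intro sum.cong) auto
  qed
  ultimately show ?case by simp
qed

text \<open>For \<open>n > 0\<close>, one of the \<open>n\<close> quotients
  \<open>pabs z / \<rho>\<close> cancels the factor \<open>\<rho>\<close> of the term bound and
  leaves \<open>pabs z\<close>; the other quotients are below 1.\<close>

lemma pabs_padic_log_le:
  assumes z: "pabs (z :: 'a) < \<rho>"
  shows "pabs (padic_log (1 + z)) \<le> pabs z"
proof (rule pabs_sums_le[OF padic_log_sums[OF z]])
  fix n
  show "pabs (fps_ln 1 $ n * z ^ n) \<le> pabs z"
  proof (cases n)
    case (Suc m)
    have "pabs (fps_ln 1 $ n * z ^ n) \<le> \<rho> * (pabs z / \<rho>) ^ n"
      using pabs_fps_ln_power_term[of 1 n z] by simp
    also have "\<dots> = pabs z * (pabs z / \<rho>) ^ m"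
      using Suc less_imp_neq[OF exp_radius_pos] by simp
    also have "\<dots> \<le> pabs z"
      using radius_quotient_less_1[OF z] less_imp_le[OF exp_radius_pos]
      by (intro mult_left_le power_le_one) auto
    finally show ?thesis .
  qed simp
qed

text \<open>The formal identity \<open>fps_exp_compose_ln\<close> evaluated at \<open>z\<close>. Row
  \<open>k\<close> of the double series \<open>a k n\<close> sums to the \<open>k\<close>-th term of
  the exponential, column \<open>n\<close> to the \<open>n\<close>-th term of the binomial series,
  and \<open>sums_triangle_swap\<close> compares the two.\<close>

lemma padic_exp_log_sums:
  assumes z: "pabs (z :: 'a) < \<rho>" and cz: "pabs (c * z) < \<rho>"
  shows "(\<lambda>n. (c gchoose n) * z ^ n) sums padic_exp (c * padic_log (1 + z))"
proof -
  \<comment> \<open>The maximum merges the conditions on \<open>z\<close> and \<open>c * z\<close>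
    into one ratio below 1; as \<open>a k n\<close> vanishes unless \<open>k \<le> n\<close>, it
    also absorbs \<open>pabs c ^ k\<close>.\<close>
  define \<theta> where "\<theta> = max 1 (pabs c) * pabs z / \<rho>"
  define a where "a k n = c ^ k / fact k * ((fps_ln 1 ^ k) $ n * z ^ n)" for k n
  have \<theta>: "0 \<le> \<theta>" "\<theta> < 1"
  proof -
    show "0 \<le> \<theta>"
      unfolding \<theta>_def using less_imp_le[OF exp_radius_pos]
      by (intro divide_nonneg_nonneg mult_nonneg_nonneg) auto
    have "max 1 (pabs c) * pabs z < \<rho>"
      using z cz by (auto simp: max_def pabs_mult)
    then show "\<theta> < 1" unfolding \<theta>_def by (rule radius_quotient_less_1)
  qed
  have zero: "a k n = 0" if "n < k" for k n
    using startsby_zero_power_prefix[of "fps_ln 1 :: 'a fps" k] that by (simp add: a_def)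
  have bound: "pabs (a k n) \<le> 1 * \<theta> ^ n" for k n
  proof (cases "n < k")
    case True
    then show ?thesis using \<theta> by (simp add: zero)
  next
    case False
    have "pabs (c ^ k / fact k) \<le> pabs c ^ k * (1 / \<rho> ^ k)"
      using mult_left_mono[OF inverse_fact_le'[of k], of "pabs c ^ k"]
      by (simp add: pabs_divide pabs_power)
    then have "pabs (a k n) \<le> (pabs c ^ k * (1 / \<rho> ^ k)) * (\<rho> ^ k * (pabs z / \<rho>) ^ n)"
      unfolding a_def by (intro pabs_mult_le pabs_fps_ln_power_term)
    also have "\<dots> = pabs c ^ k * (pabs z / \<rho>) ^ n"
      using less_imp_neq[OF exp_radius_pos] by simp
    also have "\<dots> \<le> max 1 (pabs c) ^ n * (pabs z / \<rho>) ^ n"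
    proof (rule mult_right_mono)
      have "pabs c ^ k \<le> max 1 (pabs c) ^ k" by (intro power_mono) auto
      also have "\<dots> \<le> max 1 (pabs c) ^ n" using False by (intro power_increasing) auto
      finally show "pabs c ^ k \<le> max 1 (pabs c) ^ n" .
    qed (use less_imp_le[OF exp_radius_pos] in auto)
    also have "\<dots> = \<theta> ^ n"
      by (simp add: \<theta>_def power_mult_distrib power_divide)
    finally show ?thesis by simp
  qed
  have cols: "(\<Sum>k\<le>n. a k n) = (c gchoose n) * z ^ n" for n
  proof -
    have "(c gchoose n) = (\<Sum>k\<le>n. c ^ k / fact k * (fps_ln 1 ^ k) $ n)"
      using arg_cong[OF fps_exp_compose_ln[of c], of "\<lambda>f. f $ n"]
      by (simp add: fps_compose_nth atLeast0AtMost)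
    then show ?thesis by (simp add: a_def sum_distrib_right mult.assoc)
  qed
  have "summable (\<lambda>n. \<Sum>k\<le>n. a k n)"
    by (rule summable_geometric_bound[of _ 1 \<theta>]) (use bound \<theta> in \<open>auto intro!: pabs_sum_le\<close>)
  then obtain l where l: "(\<lambda>n. \<Sum>k\<le>n. a k n) sums l" by (auto simp: summable_def)
  have rows: "a k sums (c ^ k / fact k * padic_log (1 + z) ^ k)" for k
    unfolding a_def by (intro sums_cmult_pabs padic_log_power_sums z)
  have "(\<lambda>k. c ^ k / fact k * padic_log (1 + z) ^ k) sums l"
    by (rule sums_triangle_swap[OF bound \<theta> zero rows l])
  then have "padic_exp (c * padic_log (1 + z)) = l"
    by (simp add: padic_exp_def sums_iff power_mult_distrib)
  with l show ?thesis by (simp add: cols)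
qed

text \<open>The terms from degree 2 on are at most \<open>pabs z * \<theta>\<close> with
  \<open>\<theta> < 1\<close>, so for nonzero \<open>z\<close> the linear term strictly dominates
  and \<open>pabs_add_eq\<close> gives equality.\<close>

lemma pabs_padic_exp_minus_1:
  assumes z: "pabs (z :: 'a) < \<rho>"
  shows "pabs (padic_exp z - 1) = pabs z"
proof -
  define \<theta> where "\<theta> = pabs z / \<rho>"
  have \<theta>: "0 \<le> \<theta>" "\<theta> < 1" "pabs z = \<rho> * \<theta>"
    using radius_quotient_less_1[OF z] less_imp_neq[OF exp_radius_pos, symmetric]
    by (simp_all add: \<theta>_def less_imp_le[OF exp_radius_pos])
  have "pabs (z ^ k / fact k) \<le> 1 * \<theta> ^ k" for k
    using mult_left_mono[OF inverse_fact_le'[of k], of "pabs z ^ k"]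
    by (simp add: pabs_divide pabs_power \<theta>_def power_divide)
  then have "summable (\<lambda>k. z ^ k / fact k)"
    by (rule summable_geometric_bound) (use \<theta> in auto)
  then have sums: "(\<lambda>k. z ^ k / fact k) sums padic_exp z"
    by (simp add: padic_exp_def summable_sums)
  have "pabs (z ^ k / fact k) \<le> pabs z * \<theta>" if k: "k \<ge> 2" for k
  proof -
    have "pabs (z ^ k / fact k) \<le> pabs z ^ k * (\<rho> / \<rho> ^ k)"
      using mult_left_mono[OF inverse_fact_le[of k], of "pabs z ^ k"] k
      by (simp add: pabs_divide pabs_power)
    also have "\<dots> = \<rho> * \<theta> ^ k" by (simp add: \<theta>_def power_divide)
    also have "\<dots> \<le> \<rho> * \<theta> ^ 2"
      using \<theta> k less_imp_le[OF exp_radius_pos] by (intro mult_left_mono power_decreasing) auto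
    finally show ?thesis by (simp add: \<theta>(3) power2_eq_square mult_ac)
  qed
  then have "pabs (padic_exp z - (\<Sum>k<2. z ^ k / fact k)) \<le> pabs z * \<theta>"
    by (intro sums_tail_le[OF sums] mult_nonneg_nonneg pabs_nonneg \<theta>(1)) auto
  then have *: "pabs (padic_exp z - 1 - z) \<le> pabs z * \<theta>"
    by (simp add: numeral_2_eq_2 diff_diff_eq)
  show ?thesis
  proof (cases "z = 0")
    case True
    then show ?thesis using * pabs_nonneg[of "padic_exp z - 1"] by (intro antisym) simp_all
  next
    case False
    then have "pabs z * \<theta> < pabs z"
      using mult_strict_left_mono[OF \<theta>(2) pabs_pos] by simp
    then show ?thesis using * pabs_add_eq[of "padic_exp z - 1 - z" z] by simp
  qed
qed

end

section \<open>q-powers and q-numbers\<close>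

locale padic_q_number = padic_valued_field p ty
  for p and ty :: "'a :: {field_char_0, complete_space} itself" +
  fixes q :: 'a
  assumes q_near_1: "pabs (q - 1) < \<rho>"
begin

lemma pabs_log_q_le: "pabs (padic_log q) \<le> pabs (q - 1)"
  using pabs_padic_log_le[OF q_near_1] by simp

lemma pabs_mult_log_q_less: "pabs s \<le> 1 \<Longrightarrow> pabs (s * padic_log q) < \<rho>"
  using pabs_mult_le_1[OF _ pabs_log_q_le, of s] q_near_1 by linarith

lemma pabs_q: "pabs q = 1"
  using pabs_add_eq[of "q - 1" 1] q_near_1 exp_radius_less_1 by simp

lemma q_power_sums:
  assumes "pabs s \<le> 1"
  shows "(\<lambda>n. (s gchoose n) * (q - 1) ^ n) sums q_power q s"
  using padic_exp_log_sums[OF q_near_1, of s] pabs_mult_le_1[OF assms, of "q - 1" "pabs (q - 1)"]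
    q_near_1 by (simp add: q_power_def)

lemma q_power_0: "q_power q 0 = 1"
  using pabs_padic_exp_minus_1[of 0] exp_radius_pos by (simp add: q_power_def)

text \<open>Pascal's rule, applied to the series in \<open>q_power_sums\<close>, takes the place of
  the addition theorem for the exponential. Unit steps are enough because the variable of a Riemann
  sum runs through natural numbers.\<close>

lemma q_power_plus_1:
  assumes s: "pabs s \<le> 1"
  shows "q_power q (s + 1) = q * q_power q s"
proof -
  have s1: "pabs (s + 1) \<le> 1" using s by (intro pabs_add_le) auto
  let ?f = "\<lambda>n. (s gchoose n) * (q - 1) ^ n"
  from sums_split_first[OF q_power_sums[OF s]]
  have "(\<lambda>n. (q - 1) * ?f n + ?f (Suc n)) sums ((q - 1) * q_power q s + (q_power q s - 1))"
    by (intro sums_add_pabs sums_cmult_pabs q_power_sums s) simp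
  moreover have "(\<lambda>n. (q - 1) * ?f n + ?f (Suc n)) sums (q_power q (s + 1) - 1)"
    using sums_split_first[OF q_power_sums[OF s1]]
    by (simp add: gbinomial_Suc_Suc distrib_left distrib_right mult_ac)
  ultimately have "(q - 1) * q_power q s + (q_power q s - 1) = q_power q (s + 1) - 1"
    by (rule sums_unique2)
  then show ?thesis by (simp add: algebra_simps)
qed

lemma q_power_add_of_nat:
  assumes s: "pabs s \<le> 1"
  shows "q_power q (s + of_nat k) = q_power q s * q ^ k"
proof (induction k)
  case (Suc k)
  have "pabs (s + of_nat k) \<le> 1" using s by (intro pabs_add_le pabs_of_nat_le_1)
  from q_power_plus_1[OF this] Suc show ?case by (simp add: ac_simps)
qed simp

lemma q_power_of_nat: "q_power q (of_nat k) = q ^ k"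
  using q_power_add_of_nat[of 0 k] by (simp add: q_power_0)

text \<open>A division-free form of the definition that also covers \<open>q = 1\<close>, where the
  logarithm vanishes and \<open>q_power\<close> is constantly 1.\<close>

lemma q_power_eq: "q_power q s = 1 + (q - 1) * q_number q s"
proof (cases "q = 1")
  case True
  then have "padic_log q = 0" using pabs_log_q_le pabs_nonneg[of "padic_log q"]
    by (metis antisym diff_self pabs_0 pabs_eq_0_iff)
  then show ?thesis using True q_power_0 by (simp add: q_power_def)
next
  case False
  then have "(q - 1) * q_number q s = q_power q s - 1"
    by (simp add: q_number_def field_simps)
  then show ?thesis by simp
qed

text \<open>By \<open>pabs_padic_exp_minus_1\<close> the absolute value of
  \<open>q_power q s - 1\<close> is \<open>pabs s * pabs (padic_log q)\<close>. The case
  \<open>s = 1\<close> evaluates the last factor as \<open>pabs (q - 1)\<close>, which the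
  denominator cancels.\<close>

lemma pabs_q_number:
  assumes s: "pabs s \<le> 1"
  shows "pabs (q_number q s) = pabs s"
proof (cases "q = 1")
  case False
  have *: "pabs (q_power q s - 1) = pabs s * pabs (padic_log q)" if "pabs s \<le> 1" for s
    using pabs_padic_exp_minus_1[OF pabs_mult_log_q_less[OF that]]
    by (simp add: q_power_def pabs_mult)
  have "pabs (q - 1) = pabs (padic_log q)"
    using *[of 1] q_power_of_nat[of 1] by simp
  then have "pabs (q_power q s - 1) = pabs s * pabs (q - 1)" using *[OF s] by simp
  then show ?thesis
    using False pabs_diff_commute[of 1 "q_power q s"] pabs_diff_commute[of 1 q]
    by (simp add: q_number_def pabs_divide)
qed (simp add: q_number_def)

lemma pabs_q_number_of_nat: "pabs (q_number q (of_nat k)) = pabs (of_nat k :: 'a)"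
  by (rule pabs_q_number[OF pabs_of_nat_le_1])

lemma pabs_q_number_le_1: "pabs s \<le> 1 \<Longrightarrow> pabs (q_number q s) \<le> 1"
  by (simp add: pabs_q_number)

lemma pabs_q_power_le_1: "pabs s \<le> 1 \<Longrightarrow> pabs (q_power q s) \<le> 1"
  using q_near_1 exp_radius_less_1
  by (subst q_power_eq) (intro pabs_add_le pabs_mult_le_1 pabs_q_number_le_1; simp)

lemma q_number_add_of_nat:
  assumes s: "pabs s \<le> 1"
  shows "q_number q (s + of_nat k) = q_number q s + q_power q s * q_number q (of_nat k)"
proof (cases "q = 1")
  case True
  then show ?thesis using q_power_eq[of s] by (simp add: q_number_def)
next
  case False
  have "(q - 1) * q_number q (s + of_nat k) = q_power q s * q_power q (of_nat k) - 1"
    using q_power_eq[of "s + of_nat k"] q_power_add_of_nat[OF s, of k]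
    by (simp add: q_power_of_nat)
  also have "\<dots> = (q - 1) * (q_number q s + q_power q s * q_number q (of_nat k))"
    unfolding q_power_eq[of "of_nat k"] using q_power_eq[of s] by (simp add: algebra_simps)
  finally show ?thesis using False by simp
qed

end

section \<open>Vanishing power series and increments of powers\<close>

context padic_valued_field
begin

text \<open>Once all lower coefficients vanish, \<open>d k * t ^ k\<close> is minus the tail of the
  series, which is of higher order in \<open>t\<close>. Testing at powers of \<open>p\<close>
  tending to 0 forces \<open>d k = 0\<close>.\<close>

lemma power_series_eq_0:
  fixes d :: "nat \<Rightarrow> 'a"
  assumes \<delta>: "0 < \<delta>" and sums: "\<And>t. pabs t < \<delta> \<Longrightarrow> (\<lambda>k. d k * t ^ k) sums 0"
  shows "d k = 0"
proof (induction k rule: less_induct)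
  case (less k)
  define z :: "nat \<Rightarrow> 'a" where "z j = of_nat (p ^ j)" for j
  have pabs_z: "pabs (z j) = (1 / real p) ^ j" for j
    by (simp add: z_def pabs_power pabs_p)
  have p: "0 < 1 / real p" "1 / real p < 1" using p_gt_1 by auto
  have pow0: "(\<lambda>j. (1 / real p) ^ j) \<longlonglongrightarrow> 0"
    using p by (intro LIMSEQ_realpow_zero) auto
  from order_tendstoD(2)[OF this \<delta>] obtain M where M: "(1 / real p) ^ M < \<delta>"
    unfolding eventually_sequentially by blast
  define r where "r = (1 / real p) ^ M"
  have r: "0 < r" using p by (simp add: r_def)
  have "\<exists>C. \<forall>k. pabs (d k) * r ^ k \<le> C"
  proof -
    have S: "(\<lambda>k. d k * z M ^ k) sums 0" using M by (intro sums) (simp add: pabs_z)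
    have "(\<lambda>n. (\<Sum>i<Suc n. d i * z M ^ i) + (- 1) * (\<Sum>i<n. d i * z M ^ i)) \<longlonglongrightarrow> 0 + (- 1) * 0"
      using S unfolding sums_def by (intro tendsto_add_pabs tendsto_cmult_pabs LIMSEQ_Suc)
    then have "(\<lambda>k. pabs (d k * z M ^ k)) \<longlonglongrightarrow> 0"
      unfolding tendsto_iff_pabs by simp
    then have "(\<lambda>k. pabs (d k) * r ^ k) \<longlonglongrightarrow> 0"
      by (simp add: pabs_mult pabs_power pabs_z r_def)
    then have "Bseq (\<lambda>k. pabs (d k) * r ^ k)"
      using convergent_def convergent_imp_Bseq by blast
    then obtain K where "\<forall>k. norm (pabs (d k) * r ^ k) \<le> K" by (elim BseqE)
    then show ?thesis unfolding real_norm_def by (blast intro: abs_le_D1)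
  qed
  then obtain C where C: "pabs (d k) * r ^ k \<le> C" for k by blast
  have bound: "pabs (d k) * r ^ k \<le> C * (1 / real p) ^ j" for j
  proof -
    define t where "t = z (M + j)"
    have pabs_t: "pabs t = r * (1 / real p) ^ j"
      by (simp add: t_def pabs_z r_def power_add)
    have "(1 / real p) ^ j \<le> 1" using p by (intro power_le_one) auto
    then have "pabs t \<le> r" using r by (simp add: pabs_t mult_left_le)
    then have S: "(\<lambda>k. d k * t ^ k) sums 0" using M by (intro sums) (simp add: r_def)
    have C0: "0 \<le> C" using pabs_le_imp_nonneg[of "d 0" C] C[of 0] by simp
    have "pabs (0 - (\<Sum>i<Suc k. d i * t ^ i)) \<le> C * ((1 / real p) ^ j) ^ Suc k"
    proof (rule sums_tail_le[OF S])
      fix n assume n: "n \<ge> Suc k"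
      have "pabs (d n * t ^ n) = (pabs (d n) * r ^ n) * ((1 / real p) ^ j) ^ n"
        by (simp add: pabs_mult pabs_power pabs_t power_mult_distrib)
      also have "\<dots> \<le> C * ((1 / real p) ^ j) ^ Suc k"
        using C C0 r p n
        by (intro mult_mono power_decreasing power_le_one mult_nonneg_nonneg zero_le_power) auto
      finally show "pabs (d n * t ^ n) \<le> C * ((1 / real p) ^ j) ^ Suc k" .
    qed (use C0 in auto)
    moreover have "(\<Sum>i<Suc k. d i * t ^ i) = d k * t ^ k"
      using less by simp
    \<comment> \<open>The tail starts at \<open>Suc k\<close>, so after cancelling the
      \<open>k\<close>-th power one factor \<open>(1 / p) ^ j\<close> survives and tends to
      0.\<close>
    ultimately have "(pabs (d k) * r ^ k) * ((1 / real p) ^ j) ^ k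
        \<le> (C * (1 / real p) ^ j) * ((1 / real p) ^ j) ^ k"
      by (simp add: pabs_mult pabs_power pabs_t power_mult_distrib mult_ac)
    then show ?thesis by (rule mult_right_le_imp_le) (use p in auto)
  qed
  have "(\<lambda>j. C * (1 / real p) ^ j) \<longlonglongrightarrow> 0"
    using pow0 by (rule tendsto_mult_right_zero)
  then have "pabs (d k) * r ^ k \<le> 0"
    by (rule LIMSEQ_le_const) (use bound in auto)
  moreover have "0 < pabs (d k) * r ^ k" if "d k \<noteq> 0"
    using that r by (intro mult_pos_pos pabs_pos zero_less_power)
  ultimately show ?case by fastforce
qed

text \<open>A second-order Taylor estimate. The remainder \<open>E\<close> at exponent
  \<open>l\<close> becomes \<open>(a + b) * E + l * a ^ (l - 1) * b ^ 2\<close> at the next one, and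
  all factors besides \<open>E\<close> and \<open>b ^ 2\<close> lie in the unit ball.\<close>

lemma pabs_power_add_diff:
  assumes a: "pabs (a :: 'a) \<le> 1" and b: "pabs b \<le> 1"
  shows "pabs ((a + b) ^ l - a ^ l - of_nat l * a ^ (l - 1) * b) \<le> pabs b ^ 2"
proof (induction l)
  case (Suc l)
  define E where "E = (a + b) ^ l - a ^ l - of_nat l * a ^ (l - 1) * b"
  \<comment> \<open>For \<open>l = 0\<close> the truncated exponent \<open>l - 1\<close> is
    harmless, as the factor \<open>of_nat l\<close> is zero.\<close>
  have l: "of_nat l * a ^ (l - 1) * a = of_nat l * a ^ l" by (cases l) auto
  have "(a + b) ^ Suc l = (E + a ^ l + of_nat l * a ^ (l - 1) * b) * (a + b)"
    by (simp add: E_def mult.commute)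
  also have "\<dots> = (a + b) * E + a ^ Suc l + a ^ l * b + (of_nat l * a ^ (l - 1) * a) * b
      + of_nat l * a ^ (l - 1) * b ^ 2"
    by (simp add: algebra_simps power2_eq_square)
  finally have "(a + b) ^ Suc l - a ^ Suc l - of_nat (Suc l) * a ^ (Suc l - 1) * b
      = (a + b) * E + of_nat l * a ^ (l - 1) * b ^ 2"
    unfolding l by (simp add: algebra_simps)
  also have "pabs \<dots> \<le> pabs b ^ 2"
    using a b Suc
    by (intro pabs_add_le pabs_mult_le_1 pabs_of_nat_le_1 pabs_power_le_1)
       (auto simp: E_def pabs_power intro!: pabs_add_le)
  finally show ?case .
qed auto

lemma pabs_power_diff_le:
  assumes a: "pabs (a :: 'a) \<le> 1" and b: "pabs b \<le> 1"
  shows "pabs ((a + b) ^ l - a ^ l) \<le> pabs b"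
proof -
  have "pabs b ^ 2 \<le> pabs b"
    using b by (simp add: power2_eq_square mult_left_le)
  then have "pabs (((a + b) ^ l - a ^ l - of_nat l * a ^ (l - 1) * b)
      + of_nat l * a ^ (l - 1) * b) \<le> pabs b"
    using pabs_power_add_diff[OF a b, of l]
    by (intro pabs_add_le pabs_mult_le_1 pabs_of_nat_le_1 pabs_power_le_1 a) auto
  then show ?thesis by simp
qed

end

context padic_q_number
begin

subsection \<open>Riemann sums\<close>

definition riemann_sum :: "nat \<Rightarrow> (nat \<Rightarrow> 'a) \<Rightarrow> 'a" where
  "riemann_sum N f =
     1 / q_number q (of_nat (p ^ N)) * (\<Sum>y<p ^ N. f y * q_power q (of_nat y))"

lemma q_integral_conv_riemann_sum:
  "q_integral p q f = lim (\<lambda>N. riemann_sum N (\<lambda>y. f (of_nat y)))"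
  by (simp add: q_integral_def riemann_sum_def)

lemma pabs_q_number_p_power: "pabs (q_number q (of_nat (p ^ N))) = 1 / real p ^ N"
  by (subst pabs_q_number_of_nat) (simp add: pabs_power pabs_p power_divide)

lemma pabs_inverse_q_number_p_power:
  "pabs (1 / q_number q (of_nat (p ^ N))) = real p ^ N"
  unfolding pabs_divide pabs_q_number_p_power by simp

lemma q_number_p_power_neq_0: "q_number q (of_nat (p ^ N)) \<noteq> 0"
  using pabs_q_number_p_power[of N] p_gt_1 by auto

lemma q_number_mult_of_nat:
  "q_number q (of_nat (k * M)) = q_number q (of_nat M) * (\<Sum>i<k. q ^ (i * M))"
proof (induction k)
  case 0
  then show ?case using pabs_q_number_of_nat[of 0] by simp
next
  case (Suc k)
  have "q_number q (of_nat (Suc k * M)) = q_number q (of_nat (k * M) + of_nat M)"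
    by (simp add: add.commute)
  also have "\<dots> = q_number q (of_nat (k * M)) + q ^ (k * M) * q_number q (of_nat M)"
    by (subst q_number_add_of_nat) (simp_all add: pabs_of_nat_le_1 q_power_of_nat del: of_nat_mult)
  finally show ?case unfolding Suc by (simp add: algebra_simps)
qed

text \<open>The indices below \<open>p ^ Suc N\<close> are grouped as \<open>y + j * p ^ N\<close>.
  By \<open>q_number_mult_of_nat\<close>, \<open>[p^N]\<close> times the sum of the
  \<open>q ^ (j * p ^ N)\<close> is \<open>[p^(N+1)]\<close>, which brings the coarser sum over the
  same denominator.\<close>

lemma riemann_sum_Suc_diff:
  "riemann_sum (Suc N) f - riemann_sum N f =
     1 / q_number q (of_nat (p ^ Suc N)) *
       (\<Sum>y<p ^ N. \<Sum>j<p. q ^ (y + j * p ^ N) * (f (y + j * p ^ N) - f y))"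
proof -
  let ?u = "\<lambda>N. q_number q (of_nat (p ^ N))"
  have "(\<Sum>y<p ^ Suc N. f y * q ^ y) = (\<Sum>j<p. \<Sum>y<p ^ N. f (y + j * p ^ N) * q ^ (y + j * p ^ N))"
  proof -
    have "sum (\<lambda>y. f y * q ^ y) {j * p ^ N..<j * p ^ N + p ^ N}
        = (\<Sum>y<p ^ N. f (y + j * p ^ N) * q ^ (y + j * p ^ N))" for j
      using sum.shift_bounds_nat_ivl[of "\<lambda>y. f y * q ^ y" 0 "j * p ^ N" "p ^ N"]
      by (simp add: atLeast0LessThan add.commute)
    then show ?thesis
      using sum.nat_group[of "\<lambda>y. f y * q ^ y" "p ^ N" p] by simp
  qed
  also have "\<dots> = (\<Sum>y<p ^ N. \<Sum>j<p. f (y + j * p ^ N) * q ^ (y + j * p ^ N))"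
    by (rule sum.swap)
  finally have 1: "riemann_sum (Suc N) f = 1 / ?u (Suc N) *
      (\<Sum>y<p ^ N. \<Sum>j<p. f (y + j * p ^ N) * q ^ (y + j * p ^ N))"
    by (simp add: riemann_sum_def q_power_of_nat)
  have u: "?u (Suc N) = ?u N * (\<Sum>j<p. q ^ (j * p ^ N))"
    using q_number_mult_of_nat[of p "p ^ N"] by simp
  have "(\<Sum>y<p ^ N. \<Sum>j<p. f y * q ^ (y + j * p ^ N))
      = (\<Sum>y<p ^ N. f y * q ^ y) * (\<Sum>j<p. q ^ (j * p ^ N))"
    unfolding sum_product by (simp add: power_add mult_ac)
  then have 2: "riemann_sum N f = 1 / ?u (Suc N) *
      (\<Sum>y<p ^ N. \<Sum>j<p. f y * q ^ (y + j * p ^ N))"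
    using q_number_p_power_neq_0[of "Suc N"] q_number_p_power_neq_0[of N]
    unfolding u by (simp add: riemann_sum_def q_power_of_nat)
  show ?thesis
    unfolding 1 2 right_diff_distrib[symmetric] sum_subtractf[symmetric]
    by (simp add: algebra_simps)
qed

lemma pabs_of_nat_mult_p_power: "pabs (of_nat (j * p ^ N) :: 'a) \<le> 1 / real p ^ N"
  using pabs_mult_le_1[OF pabs_of_nat_le_1 order_refl, of j "of_nat (p ^ N)"]
  by (simp add: pabs_power pabs_p power_divide)

text \<open>A refinement costs \<open>p ^ Suc N\<close> from the denominator and gains
  \<open>1 / p ^ N\<close> from the Lipschitz bound, so every increment is at most
  \<open>p * C\<close>; ultrametric addition does not let these accumulate.\<close>

lemma pabs_riemann_sum_le:
  assumes f0: "pabs (f 0) \<le> C"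
    and lip: "\<And>y k. pabs (f (y + k) - f y) \<le> C * pabs (of_nat k :: 'a)"
  shows "pabs (riemann_sum N f) \<le> real p * C"
proof (induction N)
  case 0
  have "q_number q 1 = 1"
    using q_power_of_nat[of 1] by (cases "q = 1") (auto simp: q_number_def)
  then have "pabs (riemann_sum 0 f) \<le> C"
    using f0 by (simp add: riemann_sum_def q_power_0)
  also have "C \<le> real p * C"
    using pabs_le_imp_nonneg[OF f0] p_gt_1 by (simp add: mult_le_cancel_right1)
  finally show ?case .
next
  case (Suc N)
  have C: "0 \<le> C" using f0 by (rule pabs_le_imp_nonneg)
  have "pabs (\<Sum>y<p ^ N. \<Sum>j<p. q ^ (y + j * p ^ N) * (f (y + j * p ^ N) - f y))
      \<le> C * (1 / real p ^ N)"
  proof (intro pabs_sum_le)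
    fix y j
    have "C * pabs (of_nat (j * p ^ N) :: 'a) \<le> C * (1 / real p ^ N)"
      using C by (intro mult_left_mono pabs_of_nat_mult_p_power)
    then show "pabs (q ^ (y + j * p ^ N) * (f (y + j * p ^ N) - f y)) \<le> C * (1 / real p ^ N)"
      by (intro pabs_mult_le_1 pabs_power_le_1 order_trans[OF lip]) (simp_all add: pabs_q)
  qed (use C in auto)
  then have "pabs (riemann_sum (Suc N) f - riemann_sum N f)
      \<le> (real p ^ Suc N) * (C * (1 / real p ^ N))"
    unfolding riemann_sum_Suc_diff
    by (rule pabs_mult_le[OF eq_refl[OF pabs_inverse_q_number_p_power]])
  then have "pabs (riemann_sum (Suc N) f - riemann_sum N f) \<le> real p * C"
    using p_gt_1 by simp
  from pabs_add_le[OF this Suc] show ?case by simp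
qed

lemma riemann_sum_cmult: "riemann_sum N (\<lambda>y. c * f y) = c * riemann_sum N f"
  by (simp add: riemann_sum_def sum_distrib_left mult_ac)

lemma riemann_sum_sum:
  "riemann_sum N (\<lambda>y. \<Sum>i\<in>A. f i y) = (\<Sum>i\<in>A. riemann_sum N (f i))"
  unfolding riemann_sum_def sum_distrib_left sum_distrib_right by (rule sum.swap)

lemma riemann_sum_add:
  "riemann_sum N (\<lambda>y. f y + g y) = riemann_sum N f + riemann_sum N g"
  by (simp add: riemann_sum_def distrib_right distrib_left sum.distrib)

lemma q_number_of_nat_add:
  "q_number q (of_nat (y + k)) = q_number q (of_nat y) + q ^ y * q_number q (of_nat k)"
  using q_number_add_of_nat[OF pabs_of_nat_le_1, of y k] by (simp add: q_power_of_nat)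

lemma pabs_q_power_mult_q_number:
  "pabs (q ^ y * q_number q (of_nat k)) = pabs (of_nat k :: 'a)"
  by (simp add: pabs_mult pabs_power pabs_q pabs_q_number_of_nat)

lemma pabs_riemann_sum_power_le:
  "pabs (riemann_sum N (\<lambda>y. q_number q (of_nat y) ^ l)) \<le> real p"
proof -
  have "pabs (riemann_sum N (\<lambda>y. q_number q (of_nat y) ^ l)) \<le> real p * 1"
  proof (rule pabs_riemann_sum_le)
    show "pabs (q_number q (of_nat 0) ^ l) \<le> 1"
      by (intro pabs_power_le_1 pabs_q_number_le_1 pabs_of_nat_le_1)
    show "pabs (q_number q (of_nat (y + k)) ^ l - q_number q (of_nat y) ^ l)
        \<le> 1 * pabs (of_nat k :: 'a)" for y k
      using pabs_power_diff_le[of "q_number q (of_nat y)" "q ^ y * q_number q (of_nat k)" l]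
      unfolding q_number_of_nat_add pabs_q_power_mult_q_number
      by (simp add: pabs_q_number_le_1 pabs_of_nat_le_1)
  qed
  then show ?thesis by simp
qed

text \<open>The increments of the Riemann sums involve \<open>[y + j p^N]^l - [y]^l\<close>. The linear part of this
  difference in \<open>[j p^N]\<close> sums over \<open>y\<close> to \<open>[p^N]\<close> times a bounded Riemann sum, which is the extra
  factor \<open>p^N\<close> that makes the sequence Cauchy.\<close>

lemma convergent_riemann_sum_power:
  "convergent (\<lambda>N. riemann_sum N (\<lambda>y. q_number q (of_nat y) ^ l))"
proof -
  define f where "f y = q_number q (of_nat y) ^ l" for y
  define c where "c y = of_nat l * q_number q (of_nat y) ^ (l - 1)" for y
  have diff: "pabs (riemann_sum (Suc N) f - riemann_sum N f - 0)
      \<le> real p ^ 2 * (1 / real p) ^ N" for N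
  proof -
    define M where "M = p ^ N"
    define b where "b y j = q ^ y * q_number q (of_nat (j * M))" for y j
    define E where "E y j = f (y + j * M) - f y - c y * b y j" for y j
    have b: "pabs (b y j) \<le> 1 / real p ^ N" for y j
      using pabs_of_nat_mult_p_power[of j N]
      by (simp add: b_def M_def pabs_q_power_mult_q_number del: of_nat_mult of_nat_power)
    have pN: "1 / real p ^ N \<le> 1" using p_gt_1 by simp
    have E: "pabs (E y j) \<le> (1 / real p ^ N) ^ 2" for y j
    proof -
      have "pabs (E y j) \<le> pabs (b y j) ^ 2"
        using pabs_power_add_diff[of "q_number q (of_nat y)" "b y j" l] b[of y j] pN
        by (simp add: E_def f_def c_def b_def q_number_of_nat_add pabs_q_number_le_1
            pabs_of_nat_le_1 del: of_nat_mult of_nat_add)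
      also have "\<dots> \<le> (1 / real p ^ N) ^ 2" by (intro power_mono b) simp
      finally show ?thesis .
    qed
    have "(\<Sum>y<M. \<Sum>j<p. q ^ (y + j * M) * (f (y + j * M) - f y))
        = (\<Sum>y<M. \<Sum>j<p. q ^ (y + j * M) * E y j + q ^ (y + j * M) * (c y * b y j))"
      by (simp add: E_def algebra_simps)
    \<comment> \<open>The linear part factors because \<open>b y j\<close> is \<open>q ^ y\<close>
      times a quantity depending on \<open>j\<close> alone. Of the two factors \<open>q ^ y\<close>,
      one is the weight of the Riemann sum and the other comes from \<open>b\<close>.\<close>
    also have "\<dots> = (\<Sum>y<M. \<Sum>j<p. q ^ (y + j * M) * E y j)
        + (\<Sum>y<M. c y * q ^ y * q ^ y) * (\<Sum>j<p. q ^ (j * M) * q_number q (of_nat (j * M)))"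
      unfolding sum.distrib sum_product b_def by (simp add: power_add mult_ac)
    also have "pabs \<dots> \<le> (1 / real p ^ N) ^ 2 * real p"
    proof (rule pabs_add_le)
      have "pabs (\<Sum>y<M. \<Sum>j<p. q ^ (y + j * M) * E y j) \<le> (1 / real p ^ N) ^ 2"
        by (intro pabs_sum_le pabs_mult_le_1 pabs_power_le_1 E) (auto simp: pabs_q)
      also have "\<dots> \<le> (1 / real p ^ N) ^ 2 * real p"
        using p_gt_1 by (simp add: field_simps)
      finally show "pabs (\<Sum>y<M. \<Sum>j<p. q ^ (y + j * M) * E y j) \<le> (1 / real p ^ N) ^ 2 * real p" .
    next
      let ?g = "\<lambda>k y. q_number q (of_nat y) ^ k"
      \<comment> \<open>Writing \<open>q ^ y\<close> as \<open>1 + (q - 1) [y]\<close> leads back to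
        Riemann sums of powers, already bounded by \<open>p\<close>. The exponent
        \<open>Suc (l - 1)\<close> also fits \<open>l = 0\<close>.\<close>
      have "riemann_sum N (\<lambda>y. c y * q ^ y)
          = riemann_sum N (\<lambda>y. of_nat l * (?g (l - 1) y + (q - 1) * ?g (Suc (l - 1)) y))"
      proof -
        have "c y * q ^ y = of_nat l * (?g (l - 1) y + (q - 1) * ?g (Suc (l - 1)) y)" for y
        proof -
          have "q ^ y = 1 + (q - 1) * q_number q (of_nat y)"
            using q_power_eq[of "of_nat y"] by (simp add: q_power_of_nat)
          then show ?thesis unfolding c_def by (simp add: distrib_left mult_ac)
        qed
        then show ?thesis by simp
      qed
      also have "\<dots> = of_nat l * (riemann_sum N (?g (l - 1))
          + (q - 1) * riemann_sum N (?g (Suc (l - 1))))"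
        by (simp only: riemann_sum_cmult riemann_sum_add)
      also have "pabs \<dots> \<le> real p"
        using q_near_1 exp_radius_less_1
        by (intro pabs_mult_le_1 pabs_of_nat_le_1 pabs_add_le pabs_riemann_sum_power_le) auto
      finally have "pabs (q_number q (of_nat M) * riemann_sum N (\<lambda>y. c y * q ^ y))
          \<le> 1 / real p ^ N * real p"
        by (intro pabs_mult_le) (simp add: M_def pabs_q_number_p_power del: of_nat_power)
      moreover have "q_number q (of_nat M) * riemann_sum N (\<lambda>y. c y * q ^ y)
          = (\<Sum>y<M. c y * q ^ y * q ^ y)"
        using q_number_p_power_neq_0[of N]
        by (simp add: riemann_sum_def q_power_of_nat M_def del: of_nat_power)
      ultimately have 1: "pabs (\<Sum>y<M. c y * q ^ y * q ^ y) \<le> 1 / real p ^ N * real p"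
        by simp
      have 2: "pabs (\<Sum>j<p. q ^ (j * M) * q_number q (of_nat (j * M))) \<le> 1 / real p ^ N"
        using b by (intro pabs_sum_le pabs_mult_le_1 pabs_power_le_1)
          (auto simp: pabs_q pabs_q_number_of_nat b_def pabs_mult pabs_power)
      show "pabs ((\<Sum>y<M. c y * q ^ y * q ^ y) * (\<Sum>j<p. q ^ (j * M) * q_number q (of_nat (j * M))))
          \<le> (1 / real p ^ N) ^ 2 * real p"
        using pabs_mult_le[OF 1 2] by (simp add: power2_eq_square mult_ac)
    qed
    finally have "pabs (riemann_sum (Suc N) f - riemann_sum N f)
        \<le> real p ^ Suc N * ((1 / real p ^ N) ^ 2 * real p)"
      unfolding riemann_sum_Suc_diff M_def
      by (rule pabs_mult_le[OF eq_refl[OF pabs_inverse_q_number_p_power]])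
    also have "\<dots> = real p ^ 2 * (1 / real p) ^ N"
      using p_gt_1 by (simp add: power2_eq_square power_divide)
    finally show ?thesis by simp
  qed
  have "(\<lambda>N. real p ^ 2 * (1 / real p) ^ N) \<longlonglongrightarrow> 0"
    using p_gt_1 by (intro tendsto_mult_right_zero LIMSEQ_realpow_zero) auto
  from tendsto_pabs_bound[OF diff this] have "(\<lambda>N. pabs (riemann_sum (Suc N) f - riemann_sum N f)) \<longlonglongrightarrow> 0"
    unfolding tendsto_iff_pabs by simp
  from convergent_pabs[OF this] show ?thesis unfolding f_def .
qed

end

section \<open>Polynomials with bounded coefficients\<close>

context padic_valued_field
begin

text \<open>This says that the Gauss norm of \<open>P\<close> is at most \<open>C\<close>.\<close>

definition coeffs_bounded :: "real \<Rightarrow> 'a poly \<Rightarrow> bool" where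
  "coeffs_bounded C P \<longleftrightarrow> (\<forall>i. pabs (coeff P i) \<le> C)"

lemma coeffs_bounded_monom: "\<lbrakk>0 \<le> C; pabs c \<le> C\<rbrakk> \<Longrightarrow> coeffs_bounded C (monom c n)"
  by (simp add: coeffs_bounded_def)

lemma coeffs_bounded_mult:
  assumes "coeffs_bounded C P" "coeffs_bounded D Q"
  shows "coeffs_bounded (C * D) (P * Q)"
  unfolding coeffs_bounded_def
proof
  fix i
  have "0 \<le> C * D"
    using assms unfolding coeffs_bounded_def by (meson mult_nonneg_nonneg pabs_le_imp_nonneg)
  then show "pabs (coeff (P * Q) i) \<le> C * D"
    using assms unfolding coeffs_bounded_def coeff_mult by (intro pabs_sum_le pabs_mult_le) auto
qed

lemma coeffs_bounded_power: "coeffs_bounded 1 P \<Longrightarrow> coeffs_bounded 1 (P ^ n)"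
proof (induction n)
  case 0
  then show ?case by (simp add: coeffs_bounded_def coeff_1)
next
  case (Suc n)
  then show ?case using coeffs_bounded_mult[of 1 P 1 "P ^ n"] by simp
qed

lemma coeffs_bounded_smult:
  "\<lbrakk>pabs c \<le> C; coeffs_bounded D P\<rbrakk> \<Longrightarrow> coeffs_bounded (C * D) (smult c P)"
  by (simp add: coeffs_bounded_def pabs_mult_le)

lemma coeffs_bounded_sum:
  "\<lbrakk>0 \<le> C; \<And>i. i \<in> A \<Longrightarrow> coeffs_bounded C (f i)\<rbrakk> \<Longrightarrow> coeffs_bounded C (sum f A)"
  by (simp add: coeffs_bounded_def coeff_sum pabs_sum_le)

end

section \<open>Stirling numbers and the degenerate binomial term\<close>

lemma stirling1_Suc_0: "stirling1 (Suc n) 0 = - int n * stirling1 n 0"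
  by (simp add: stirling1_def coeff_mult_0)

lemma stirling1_Suc_Suc: "stirling1 (Suc n) (Suc m) = stirling1 n m - int n * stirling1 n (Suc m)"
  by (simp add: stirling1_def)

lemma stirling1_eq_0: "n < m \<Longrightarrow> stirling1 n m = 0"
proof (induction n arbitrary: m)
  case 0
  then show ?case by (simp add: stirling1_def)
next
  case (Suc n)
  then show ?case by (cases m) (auto simp: stirling1_Suc_Suc)
qed

lemma prod_diff_of_nat_stirling1:
  "(\<Prod>i<n. a - of_nat i) = (\<Sum>m\<le>n. of_int (stirling1 n m) * a ^ m)" for a :: "'a :: comm_ring_1"
proof (induction n)
  case (Suc n)
  have "(\<Prod>i<Suc n. a - of_nat i) = (\<Sum>m\<le>n. of_int (stirling1 n m) * a ^ m) * (a - of_nat n)"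
    by (simp add: Suc)
  \<comment> \<open>The second sum is extended by the zero term \<open>stirling1 n (Suc n)\<close>,
    so that after an index shift the two sums fit the recursion of the Stirling numbers.\<close>
  also have "\<dots> = (\<Sum>m\<le>n. of_int (stirling1 n m) * a ^ Suc m)
      - of_nat n * (\<Sum>m\<le>Suc n. of_int (stirling1 n m) * a ^ m)"
    unfolding right_diff_distrib
    by (simp add: stirling1_eq_0 sum_distrib_right sum_distrib_left mult_ac)
  also have "\<dots> = (\<Sum>m\<le>Suc n. of_int (stirling1 (Suc n) m) * a ^ m)"
    by (simp add: sum.atMost_Suc_shift stirling1_Suc_0 stirling1_Suc_Suc algebra_simps
        sum_distrib_left sum_subtractf sum.distrib del: sum.atMost_Suc)
  finally show ?case .
qed (simp add: stirling1_def)

text \<open>The left side is \<open>a (a - lam) ... (a - (n - 1) lam) t^n / n!\<close>. Only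
  \<open>m \<le> n\<close> occurs in its expansion, so \<open>lam ^ n\<close> clears every
  denominator \<open>lam ^ m\<close>.\<close>

lemma gbinomial_degenerate_term:
  fixes lam t a :: "'a :: field_char_0"
  assumes "lam \<noteq> 0"
  shows "(a / lam gchoose n) * (lam * t) ^ n =
    (\<Sum>m\<le>n. lam ^ (n - m) * of_int (stirling1 n m) * (t ^ n / fact n) * a ^ m)"
proof -
  have "(a / lam gchoose n) * (lam * t) ^ n =
      (\<Sum>m\<le>n. of_int (stirling1 n m) * (a / lam) ^ m) / fact n * (lam ^ n * t ^ n)"
    by (simp add: gbinomial_prod_rev atLeast0LessThan prod_diff_of_nat_stirling1 power_mult_distrib)
  also have "\<dots> = (\<Sum>m\<le>n. (of_int (stirling1 n m) * (a / lam) ^ m) / fact n * (lam ^ n * t ^ n))"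
    by (simp add: sum_distrib_right sum_divide_distrib)
  also have "\<dots> = (\<Sum>m\<le>n. lam ^ (n - m) * of_int (stirling1 n m) * (t ^ n / fact n) * a ^ m)"
  proof (rule sum.cong[OF refl])
    fix m assume "m \<in> {..n}"
    then have "lam ^ n = lam ^ (n - m) * lam ^ m" by (simp flip: power_add)
    then show "(of_int (stirling1 n m) * (a / lam) ^ m) / fact n * (lam ^ n * t ^ n)
        = lam ^ (n - m) * of_int (stirling1 n m) * (t ^ n / fact n) * a ^ m"
      using assms by (simp add: power_divide)
  qed
  finally show ?thesis .
qed

context padic_q_number
begin

subsection \<open>Integration of polynomials in the q-number\<close>

text \<open>Agreement is asked for on the closed unit ball, where the addition rule for q-numbers
  holds and which is stable under adding natural numbers.\<close>

definition q_poly_fun :: "real \<Rightarrow> ('a \<Rightarrow> 'a) \<Rightarrow> bool" where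
  "q_poly_fun C h \<longleftrightarrow>
     (\<exists>P. coeffs_bounded C P \<and> (\<forall>s. pabs s \<le> 1 \<longrightarrow> h s = poly P (q_number q s)))"

definition shift_integral :: "('a \<Rightarrow> 'a) \<Rightarrow> 'a \<Rightarrow> 'a" where
  "shift_integral h s = q_integral p q (\<lambda>y. h (y + s))"

text \<open>The outermost variable is added to \<open>x\<close> and becomes the argument of the
  remaining integrals, so the \<open>r\<close>-fold integral is an iterate of one operator.\<close>

lemma q_multi_integral_sum_list:
  "q_multi_integral p q r (\<lambda>xs. h (sum_list xs + x)) = (shift_integral ^^ r) h x"
  by (induction r arbitrary: x) (simp_all add: shift_integral_def add.assoc)

lemma pabs_of_nat_add_le_1: "pabs (s :: 'a) \<le> 1 \<Longrightarrow> pabs (of_nat y + s) \<le> 1"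
  by (intro pabs_add_le pabs_of_nat_le_1)

lemma shift_integral_cong:
  assumes "\<And>s. pabs s \<le> 1 \<Longrightarrow> h s = g s" "pabs s \<le> 1"
  shows "shift_integral h s = shift_integral g s"
  using assms by (simp add: shift_integral_def q_integral_def pabs_of_nat_add_le_1)

text \<open>Expanding powers of \<open>[y + s] = [s] + q^s [y]\<close> reduces the Riemann sums to
  those of \<open>[y]^l\<close>, which are bounded by \<open>p\<close> and convergent. The
  coefficients are polynomials in \<open>[s]\<close> because \<open>q^s = 1 + (q - 1) [s]\<close>,
  and hence so is the limit.\<close>

lemma
  assumes h: "q_poly_fun C h"
  shows riemann_sum_tendsto_shift_integral:
      "pabs s \<le> 1 \<Longrightarrow> (\<lambda>N. riemann_sum N (\<lambda>y. h (of_nat y + s))) \<longlonglongrightarrow> shift_integral h s"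
    and pabs_riemann_sum_shift_le:
      "pabs s \<le> 1 \<Longrightarrow> pabs (riemann_sum N (\<lambda>y. h (of_nat y + s))) \<le> real p * C"
    and q_poly_fun_shift_integral: "q_poly_fun (real p * C) (shift_integral h)"
proof -
  obtain P where P: "coeffs_bounded C P"
    and hP: "\<And>s. pabs s \<le> 1 \<Longrightarrow> h s = poly P (q_number q s)"
    using h unfolding q_poly_fun_def by blast
  have C: "0 \<le> C" using P pabs_le_imp_nonneg unfolding coeffs_bounded_def by blast
  define R where "R N l = riemann_sum N (\<lambda>y. q_number q (of_nat y) ^ l)" for N l
  define B where "B l = lim (\<lambda>N. R N l)" for l
  have R: "(\<lambda>N. R N l) \<longlonglongrightarrow> B l" for l
    using convergent_riemann_sum_power[of l] by (simp add: R_def B_def convergent_LIMSEQ_iff)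
  have R_le: "pabs (R N l) \<le> real p" for N l
    unfolding R_def by (rule pabs_riemann_sum_power_le)
  have B_le: "pabs (B l) \<le> real p" for l
    by (rule pabs_le_lim[OF R R_le])
  define e where "e m l s = coeff P m *
      (of_nat (m choose l) * q_power q s ^ l * q_number q s ^ (m - l))" for m l s
  have e_le: "pabs (e m l s) \<le> C" if "pabs s \<le> 1" for m l s
  proof -
    have "pabs (of_nat (m choose l) * q_power q s ^ l * q_number q s ^ (m - l)) \<le> 1"
      using that by (intro pabs_mult_le_1 pabs_power_le_1 pabs_of_nat_le_1
          pabs_q_power_le_1 pabs_q_number_le_1)
    then have "pabs (e m l s) \<le> C * 1"
      using P unfolding e_def coeffs_bounded_def by (intro pabs_mult_le) auto
    then show ?thesis by simp
  qed
  have riemann: "riemann_sum N (\<lambda>y. h (of_nat y + s)) = (\<Sum>m\<le>degree P. \<Sum>l\<le>m. e m l s * R N l)"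
    if s: "pabs s \<le> 1" for s N
  proof -
    have "h (of_nat y + s) = (\<Sum>m\<le>degree P. \<Sum>l\<le>m. e m l s * q_number q (of_nat y) ^ l)" for y
    proof -
      have "q_number q (of_nat y + s) = q_power q s * q_number q (of_nat y) + q_number q s"
        using q_number_add_of_nat[OF s, of y] by (simp add: add.commute)
      then have "h (of_nat y + s)
          = (\<Sum>m\<le>degree P. coeff P m * (q_power q s * q_number q (of_nat y) + q_number q s) ^ m)"
        using s by (simp add: hP pabs_of_nat_add_le_1 poly_altdef)
      then show ?thesis
        by (simp add: binomial_ring sum_distrib_left e_def power_mult_distrib mult_ac)
    qed
    then show ?thesis by (simp add: riemann_sum_sum riemann_sum_cmult R_def)
  qed
  define L where "L s = (\<Sum>m\<le>degree P. \<Sum>l\<le>m. e m l s * B l)" for s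
  have lim: "(\<lambda>N. riemann_sum N (\<lambda>y. h (of_nat y + s))) \<longlonglongrightarrow> L s" if "pabs s \<le> 1" for s
    unfolding riemann[OF that] L_def by (intro tendsto_sum_pabs tendsto_cmult_pabs R)
  have L: "shift_integral h s = L s" if "pabs s \<le> 1" for s
    unfolding shift_integral_def q_integral_conv_riemann_sum by (rule limI[OF lim[OF that]])
  show "(\<lambda>N. riemann_sum N (\<lambda>y. h (of_nat y + s))) \<longlonglongrightarrow> shift_integral h s"
    if "pabs s \<le> 1" for s
    using lim L that by simp
  show "pabs (riemann_sum N (\<lambda>y. h (of_nat y + s))) \<le> real p * C" if "pabs s \<le> 1" for s N
    unfolding riemann[OF that] using pabs_mult_le[OF e_le[OF that] R_le] C
    by (intro pabs_sum_le) (auto simp: mult.commute)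
  \<comment> \<open>This is \<open>L\<close> with \<open>q_number q s\<close> replaced by the
    indeterminate and \<open>q_power q s\<close> by the linear polynomial
    \<open>1 + (q - 1) X\<close>.\<close>
  define J where "J = (\<Sum>m\<le>degree P. \<Sum>l\<le>m.
      smult (coeff P m * of_nat (m choose l) * B l) ([:1, q - 1:] ^ l * monom 1 (m - l)))"
  have "coeffs_bounded (real p * C) J"
    unfolding J_def
  proof (intro coeffs_bounded_sum)
    fix m l
    have 1: "pabs (coeff P m * of_nat (m choose l) * B l) \<le> C * 1 * real p"
      using P unfolding coeffs_bounded_def
      by (intro pabs_mult_le pabs_of_nat_le_1 B_le) auto
    have "coeffs_bounded 1 [:1, q - 1:]"
      using q_near_1 exp_radius_less_1
      by (auto simp: coeffs_bounded_def coeff_pCons split: nat.split)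
    then have "coeffs_bounded (1 * 1) ([:1, q - 1:] ^ l * monom 1 (m - l))"
      by (intro coeffs_bounded_mult coeffs_bounded_power coeffs_bounded_monom) auto
    from coeffs_bounded_smult[OF 1 this]
    show "coeffs_bounded (real p * C)
        (smult (coeff P m * of_nat (m choose l) * B l) ([:1, q - 1:] ^ l * monom 1 (m - l)))"
      by (simp add: mult.commute)
  qed (use C in auto)
  moreover have "shift_integral h s = poly J (q_number q s)" if "pabs s \<le> 1" for s
  proof -
    have "poly [:1, q - 1:] (q_number q s) = q_power q s"
      using q_power_eq[of s] by (simp add: mult.commute)
    then show ?thesis
      unfolding L[OF that] L_def J_def e_def
      by (simp add: poly_sum poly_monom mult_ac del: poly_pCons)
  qed
  ultimately show "q_poly_fun (real p * C) (shift_integral h)"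
    unfolding q_poly_fun_def by blast
qed

lemma q_poly_fun_funpow:
  "q_poly_fun C h \<Longrightarrow> q_poly_fun (real p ^ k * C) ((shift_integral ^^ k) h)"
proof (induction k)
  case (Suc k)
  from q_poly_fun_shift_integral[OF Suc.IH[OF Suc.prems]] show ?case by (simp add: mult_ac)
qed simp

text \<open>The integral is a \<open>lim\<close>, so linearity is available once each summand has a
  limit; membership in the polynomial class guarantees that.\<close>

lemma shift_integral_sum:
  assumes h: "\<And>i. i \<in> A \<Longrightarrow> q_poly_fun (C i) (h i)" and s: "pabs s \<le> 1"
  shows "shift_integral (\<lambda>s. \<Sum>i\<in>A. c i * h i s) s = (\<Sum>i\<in>A. c i * shift_integral (h i) s)"
proof -
  have "(\<lambda>N. riemann_sum N (\<lambda>y. \<Sum>i\<in>A. c i * h i (of_nat y + s)))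
      \<longlonglongrightarrow> (\<Sum>i\<in>A. c i * shift_integral (h i) s)"
    unfolding riemann_sum_sum riemann_sum_cmult
    by (intro tendsto_sum_pabs tendsto_cmult_pabs riemann_sum_tendsto_shift_integral[OF h s])
  then show ?thesis
    unfolding shift_integral_def[of "\<lambda>s. \<Sum>i\<in>A. c i * h i s"] q_integral_conv_riemann_sum
    by (rule limI)
qed

lemma shift_integral_funpow_sum:
  assumes h: "\<And>i. i \<in> A \<Longrightarrow> q_poly_fun (C i) (h i)" and s: "pabs s \<le> 1"
  shows "(shift_integral ^^ k) (\<lambda>s. \<Sum>i\<in>A. c i * h i s) s
    = (\<Sum>i\<in>A. c i * (shift_integral ^^ k) (h i) s)"
  using s
proof (induction k arbitrary: s)
  case (Suc k)
  have "(shift_integral ^^ Suc k) (\<lambda>s. \<Sum>i\<in>A. c i * h i s) s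
      = shift_integral (\<lambda>s. \<Sum>i\<in>A. c i * (shift_integral ^^ k) (h i) s) s"
    using shift_integral_cong[OF Suc.IH Suc.prems] by simp
  also have "\<dots> = (\<Sum>i\<in>A. c i * shift_integral ((shift_integral ^^ k) (h i)) s)"
    by (intro shift_integral_sum[OF q_poly_fun_funpow[OF h] Suc.prems])
  finally show ?case by simp
qed simp

lemma shift_integral_sums:
  assumes h: "\<And>n. q_poly_fun (C * \<theta> ^ n) (h n)" and \<theta>: "0 \<le> \<theta>" "\<theta> < 1"
    and sums: "\<And>s. pabs s \<le> 1 \<Longrightarrow> (\<lambda>n. h n s) sums g s"
    and s: "pabs s \<le> 1"
  shows "(\<lambda>n. shift_integral (h n) s) sums shift_integral g s"
proof -
  have "\<exists>l. (\<lambda>N. riemann_sum N (\<lambda>y. g (of_nat y + s))) \<longlonglongrightarrow> l \<and> (\<lambda>n. shift_integral (h n) s) sums l"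
  proof (rule sums_uniform_limit[where a = "\<lambda>N n. riemann_sum N (\<lambda>y. h n (of_nat y + s))"])
    show "pabs (riemann_sum N (\<lambda>y. h n (of_nat y + s))) \<le> (real p * C) * \<theta> ^ n" for N n
      using pabs_riemann_sum_shift_le[OF h s] by (simp add: mult.assoc)
    show "(\<lambda>N. riemann_sum N (\<lambda>y. h n (of_nat y + s))) \<longlonglongrightarrow> shift_integral (h n) s" for n
      by (rule riemann_sum_tendsto_shift_integral[OF h s])
    show "(\<lambda>n. riemann_sum N (\<lambda>y. h n (of_nat y + s))) sums riemann_sum N (\<lambda>y. g (of_nat y + s))"
      for N
    proof -
      have "(\<lambda>n. q_power q (of_nat y) * h n (of_nat y + s)) sums
          (q_power q (of_nat y) * g (of_nat y + s))" for y
        by (intro sums_cmult_pabs sums pabs_of_nat_add_le_1 s)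
      then have "(\<lambda>n. h n (of_nat y + s) * q_power q (of_nat y)) sums
          (g (of_nat y + s) * q_power q (of_nat y))" for y
        by (simp add: mult.commute)
      then show ?thesis
        unfolding riemann_sum_def by (intro sums_cmult_pabs sums_sum_pabs)
    qed
  qed (use \<theta> in auto)
  then obtain l where "(\<lambda>N. riemann_sum N (\<lambda>y. g (of_nat y + s))) \<longlonglongrightarrow> l"
    and l: "(\<lambda>n. shift_integral (h n) s) sums l" by blast
  then have "shift_integral g s = l"
    unfolding shift_integral_def q_integral_conv_riemann_sum by (intro limI)
  with l show ?thesis by simp
qed

text \<open>Every integration multiplies the constant \<open>C\<close> by \<open>p\<close> and
  leaves the ratio \<open>\<theta>\<close> untouched, so \<open>shift_integral_sums\<close> can be
  iterated.\<close>

lemma shift_integral_funpow_sums: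
  assumes h: "\<And>n. q_poly_fun (C * \<theta> ^ n) (h n)" and \<theta>: "0 \<le> \<theta>" "\<theta> < 1"
    and sums: "\<And>s. pabs s \<le> 1 \<Longrightarrow> (\<lambda>n. h n s) sums g s"
    and s: "pabs s \<le> 1"
  shows "(\<lambda>n. (shift_integral ^^ k) (h n) s) sums (shift_integral ^^ k) g s"
  using s
proof (induction k arbitrary: s)
  case (Suc k)
  have "q_poly_fun (real p ^ k * C * \<theta> ^ n) ((shift_integral ^^ k) (h n))" for n
    using q_poly_fun_funpow[OF h, of k n] by (simp add: mult.assoc)
  from shift_integral_sums[OF this \<theta> Suc.IH Suc.prems] show ?case by simp
qed (use sums in auto)

section \<open>The generating function\<close>

lemma q_poly_fun_power: "q_poly_fun 1 (\<lambda>s. q_number q s ^ m)"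
  unfolding q_poly_fun_def
  by (intro exI[of _ "monom 1 m"] conjI coeffs_bounded_monom) (auto simp: poly_monom)

text \<open>The \<open>n\<close>-th term of the integrand's series is a polynomial in
  \<open>[s]\<close> with coefficients of size at most \<open>\<theta> ^ n\<close>, so the series
  may be integrated term by term \<open>r\<close> times.\<close>

lemma degenerate_power_integral_sums:
  assumes lam: "lam \<noteq> 0" and lt: "pabs (lam * t) < \<rho>" and t: "pabs t < \<rho>"
    and x: "pabs x \<le> 1"
  shows "(\<lambda>n. (\<Sum>m\<le>n. lam ^ (n - m) * carlitz_q_bernoulli p q r m x * of_int (stirling1 n m)) *
      (t ^ n / fact n)) sums
    q_multi_integral p q r (\<lambda>xs. degenerate_power lam t (q_number q (sum_list xs + x)))"
proof -
  \<comment> \<open>The maximum combines the two radius conditions and bounds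
    \<open>lam ^ (n - m)\<close>, while \<open>\<rho>\<close> accounts for \<open>fact n\<close>;
    Stirling numbers, being integers, cost nothing.\<close>
  define \<theta> where "\<theta> = max 1 (pabs lam) * pabs t / \<rho>"
  define c where "c n m = lam ^ (n - m) * of_int (stirling1 n m) * (t ^ n / fact n)" for n m
  define h where "h n s = (\<Sum>m\<le>n. c n m * q_number q s ^ m)" for n s
  have \<theta>: "0 \<le> \<theta>" "\<theta> < 1"
  proof -
    show "0 \<le> \<theta>"
      unfolding \<theta>_def using less_imp_le[OF exp_radius_pos]
      by (intro divide_nonneg_nonneg mult_nonneg_nonneg) auto
    have "max 1 (pabs lam) * pabs t < \<rho>"
      using t lt by (auto simp: max_def pabs_mult)
    then show "\<theta> < 1" unfolding \<theta>_def by (rule radius_quotient_less_1)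
  qed
  have c_le: "pabs (c n m) \<le> 1 * \<theta> ^ n" if "m \<le> n" for n m
  proof -
    have "pabs lam ^ (n - m) \<le> max 1 (pabs lam) ^ (n - m)" by (intro power_mono) auto
    also have "\<dots> \<le> max 1 (pabs lam) ^ n" by (intro power_increasing) auto
    finally have "pabs (lam ^ (n - m) * of_int (stirling1 n m)) \<le> max 1 (pabs lam) ^ n * 1"
      by (intro pabs_mult_le pabs_of_int_le_1) (simp add: pabs_power)
    moreover have "pabs (t ^ n / fact n) \<le> pabs t ^ n * (1 / \<rho> ^ n)"
      using mult_left_mono[OF inverse_fact_le'[of n], of "pabs t ^ n"]
      by (simp add: pabs_divide pabs_power)
    ultimately have "pabs (c n m) \<le> (max 1 (pabs lam) ^ n * 1) * (pabs t ^ n * (1 / \<rho> ^ n))"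
      unfolding c_def by (rule pabs_mult_le)
    then show ?thesis by (simp add: \<theta>_def power_mult_distrib power_divide)
  qed
  have h: "q_poly_fun (1 * \<theta> ^ n) (h n)" for n
    unfolding q_poly_fun_def
  proof (intro exI conjI allI impI)
    show "coeffs_bounded (1 * \<theta> ^ n) (\<Sum>m\<le>n. monom (c n m) m)"
      using \<theta> c_le by (intro coeffs_bounded_sum coeffs_bounded_monom) auto
    show "h n s = poly (\<Sum>m\<le>n. monom (c n m) m) (q_number q s)" for s
      by (simp add: h_def poly_sum poly_monom)
  qed
  have sums: "(\<lambda>n. h n s) sums degenerate_power lam t (q_number q s)" if "pabs s \<le> 1" for s
  proof -
    \<comment> \<open>Here \<open>lam\<close> cancels, and \<open>[s]\<close> lies in the unit ball,
      so \<open>pabs t < \<rho>\<close> suffices.\<close>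
    have "pabs (q_number q s / lam * (lam * t)) < \<rho>"
      using pabs_mult_le_1[OF pabs_q_number_le_1[OF that] order_refl, of t] t lam by simp
    from padic_exp_log_sums[OF lt this] show ?thesis
      by (simp add: degenerate_power_def h_def c_def gbinomial_degenerate_term[OF lam])
  qed
  have "(shift_integral ^^ r) (h n) x =
      (\<Sum>m\<le>n. lam ^ (n - m) * carlitz_q_bernoulli p q r m x * of_int (stirling1 n m)) *
        (t ^ n / fact n)" for n
  proof -
    have "(shift_integral ^^ r) (h n) x
        = (\<Sum>m\<le>n. c n m * (shift_integral ^^ r) (\<lambda>s. q_number q s ^ m) x)"
      unfolding h_def by (rule shift_integral_funpow_sum[OF q_poly_fun_power x])
    also have "\<dots> = (\<Sum>m\<le>n. c n m * carlitz_q_bernoulli p q r m x)"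
      by (simp add: carlitz_q_bernoulli_def flip: q_multi_integral_sum_list)
    finally show ?thesis unfolding sum_distrib_right by (simp add: c_def mult_ac)
  qed
  with shift_integral_funpow_sums[OF h \<theta> sums x, of r] show ?thesis
    by (simp add: q_multi_integral_sum_list
        [of r "\<lambda>s. degenerate_power lam t (q_number q s)" x])
qed

end

section \<open>Identification of the coefficients\<close>

lemma (in padic_valued_field) pabs_padic_integers_le_1:
  assumes "x \<in> (padic_integers :: 'a set)"
  shows "pabs x \<le> 1"
proof -
  have "closure (\<int> :: 'a set) \<subseteq> cball 0 1"
    by (rule closure_minimal) (auto simp: dist_conv_pabs pabs_of_int_le_1 elim: Ints_cases)
  then show ?thesis
    using assms by (auto simp: padic_integers_def dist_conv_pabs)
qed

theorem theorem6:
  fixes p r n :: nat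
    and q lam x :: "'a :: {alg_closed_field, field_char_0, complete_space}"
  assumes "padic_complex_field p TYPE('a)"
    and "pabs (q - 1) < exp_radius p"
    and "lam \<noteq> 0"
    and "x \<in> padic_integers"
  shows "degenerate_carlitz_q_bernoulli p q r n x lam =
    (\<Sum>m=0..n. lam ^ (n - m) * carlitz_q_bernoulli p q r m x * of_int (stirling1 n m))"
proof -
  interpret padic_q_number p "TYPE('a)" q
    using assms(1,2) by unfold_locales (auto simp: padic_complex_field_def)
  define I where "I t = q_multi_integral p q r
      (\<lambda>xs. degenerate_power lam t (q_number q (sum_list xs + x)))" for t
  define b where "b n =
      (\<Sum>m\<le>n. lam ^ (n - m) * carlitz_q_bernoulli p q r m x * of_int (stirling1 n m))" for n
  have b: "(\<lambda>k. b k * (t ^ k / fact k)) sums I t"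
    if "pabs (lam * t) < exp_radius p" "pabs t < exp_radius p" for t
    unfolding b_def I_def using that assms(3) pabs_padic_integers_le_1[OF assms(4)]
    by (intro degenerate_power_integral_sums)
  \<comment> \<open>\<open>THE\<close> requires uniqueness: the difference of two coefficient
    sequences yields a power series that vanishes on a disc around 0.\<close>
  have unique: "b' = b"
    if b': "\<And>t. \<lbrakk>pabs (lam * t) < exp_radius p; pabs t < exp_radius p\<rbrakk> \<Longrightarrow>
      (\<lambda>k. b' k * (t ^ k / fact k)) sums I t" for b'
  proof
    fix k
    have "(b' k - b k) / fact k = 0"
    \<comment> \<open>Every \<open>t\<close> below this radius meets both conditions on
      \<open>t\<close> in the definition.\<close>
    proof (rule power_series_eq_0[where \<delta> = "min (exp_radius p / pabs lam) (exp_radius p)"])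
      show "0 < min (exp_radius p / pabs lam) (exp_radius p)"
        using pabs_pos[OF assms(3)] by simp
      fix t :: 'a assume t: "pabs t < min (exp_radius p / pabs lam) (exp_radius p)"
      then have "pabs (lam * t) < exp_radius p"
        using pabs_pos[OF assms(3)] by (simp add: pabs_mult field_simps)
      with t have "(\<lambda>k. b' k * (t ^ k / fact k) - b k * (t ^ k / fact k)) sums (I t - I t)"
        by (intro sums_diff_pabs b b') auto
      then show "(\<lambda>k. (b' k - b k) / fact k * t ^ k) sums 0"
        by (simp add: algebra_simps diff_divide_distrib)
    qed
    then show "b' k = b k" by simp
  qed
  have "(THE b. \<forall>t. pabs (lam * t) < exp_radius p \<and> pabs t < exp_radius p \<longrightarrow>
      (\<lambda>k. b k * (t ^ k / fact k)) sums I t) = b"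
    by (rule the_equality) (use b unique in auto)
  then have "degenerate_carlitz_q_bernoulli p q r n x lam = b n"
    unfolding degenerate_carlitz_q_bernoulli_def I_def by simp
  then show ?thesis by (simp add: b_def atLeast0AtMost)
qed

end
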